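(* Let $\Sigma$ be a ranked alphabet and $L\subseteq T_\Sigma$ an arbitrary tree language. Then the following are equivalent: (a) $L$ is recognizable (by a finite-state tree automaton); (b) $L$ is $\mathrm{BTC}(\mathrm{FO}_t+\mathrm{mod})$-definable; (c) $L$ is $\mathrm{BTC}(\mathrm{MSO}_t)$-definable; (d) $L$ is $\exists\forall(\mathrm{FO}_t+\mathrm{mod})$-definable; (e) $L$ is $\exists\forall(\mathrm{MSO}_t)$-definable; (f) $L$ is $\mathrm{MSO}_t$-definable.
   Context: **Trees.** $\Sigma$ is a ranked alphabet (finite, nonempty) with maximal rank $\mathrm{maxrk}(\Sigma)$; $T_\Sigma$ is the set of $\Sigma$-trees. For $\xi\in T_\Sigma$, $\mathrm{pos}(\xi)\subseteq\mathbb N_+^*$ is the set of positions (root $\varepsilon$; the $i$-th child of $w$ is $wi$), $\xi(w)$ the label at $w$, $\mathrm{size}(\xi)=|\mathrm{pos}(\xi)|$, $\le$ the prefix order, $|w|$ the length of $w$. **Logics.** $\mathrm{MSO}_t$ is ordinary (unweighted, two-valued) monadic second-order logic over trees in $T_\Sigma$, with atomic formulas $\mathrm{label}_\sigma(x)$ (the label at $x$ is $\sigma$), $\mathrm{edge}_i(x,y)$ ($y$ is the $i$-th child of $x$, $1\le i\le \mathrm{maxrk}(\Sigma)$), $x\le y$ (prefix), $x\in X$, and with the Boolean connectives and first- and second-order quantification over positions and sets of positions. $\mathrm{FO}_t$ is its first-order fragment (no second-order quantification; second-order variables may occur free in atoms $x\in X$). $\mathrm{FO}_t+\mathrm{mod}$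 extends $\mathrm{FO}_t$ by the formulas $|x|\equiv_n m$ ($n\in\mathbb N_+$, $0\le m<n$), which hold at position $v$ iff $|v|\equiv m\pmod n$. $L$ is $\mathrm{MSO}_t$-definable if $L$ is the set of trees satisfying some $\mathrm{MSO}_t$-sentence. For a class $\mathcal L$ of formulas, $L$ is $\exists\forall(\mathcal L)$-definable if $L=\{\xi\in T_\Sigma\mid\xi\models\exists X.\forall x.\theta(X,x)\}$ for some $\theta\in\mathcal L$ with free variables $X$ and $x$. **Branching transitive closure.** Fix $n\in\mathbb N_+$. The base position $\langle v\rangle$ of a position $v$ is the unique prefix $u$ of $v$ such that $|u|$ is a multiple of $n$ and $0\le|v|-|u|<n$. For positions $v,v_1,\dots,v_k$ of $\xi$ ($k\ge0$), $\psi_k^\xi(v,v_1,\dots,v_k)$ holds iff for all $i$, $\langle v\rangle$ is a prefix of $\langle v_i\rangle$ with $|\langle v_i\rangle|=|\langle v\rangle|+n$, and $\langle v_1\rangle,\dots,\langle v_k\rangle$ are in strict left-to-right (lexicographic) order. For $m\in\mathbb N$, an $m$-family of formulas in $\mathcal L$ is $\Phi=(\varphi_k(x,y_1,\dots,y_k)\mid0\le k\le m)$ with $\varphi_k\in\mathcal L$ having free variables $x,y_1,\dots,y_k$. It is $n$-progressing if for all $k$, $\xi$ and positions $v,v_1,\dots,v_k$ of $\xi$: if $\varphi_k$ holds in $\xi$ at $(v,v_1,\dots,v_k)$ then $\psi_k^\xi(v,v_1,\dots,v_k)$ holds. With pairwise distinct first-order variables $x_w$ ($w\in\mathbb N_+^*$),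 define $\mathrm{BTC}^1_w(\Phi)=\varphi_0(x_w)$ and, for $l\ge1$, $$\mathrm{BTC}^{l+1}_w(\Phi)=\bigvee_{1\le k\le m}\exists x_{w1}\dots\exists x_{wk}.\ \varphi_k(x_w,x_{w1},\dots,x_{wk})\wedge\bigvee_{\substack{l_1,\dots,l_k\in\mathbb N_+\\l_1+\dots+l_k=l}}\ \bigwedge_{1\le i\le k}\mathrm{BTC}^{l_i}_{wi}(\Phi)$$ (an empty disjunction is false). $\mathrm{BTC}(\Phi)$ holds in $\xi$ at $v$ if $\mathrm{BTC}^l_\varepsilon(\Phi)$ holds in $\xi$ at $x_\varepsilon\mapsto v$ for some $1\le l\le\mathrm{size}(\xi)$. $L$ is $\mathrm{BTC}(\mathcal L)$-definable if there are $m\in\mathbb N$, $n\in\mathbb N_+$ and an $m$-family $\Phi$ of $n$-progressing formulas in $\mathcal L$ such that $L$ is the set of all $\xi\in T_\Sigma$ for which $\mathrm{BTC}(\Phi)$ holds in $\xi$ at $\varepsilon$. *)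

theory Defs
  imports "HOL-Library.Sublist"
begin

section \<open>Trees over a ranked alphabet\<close>

text \<open>A ranked alphabet is a finite type \<open>'s\<close> of symbols (types are nonempty) together with a rank
  function \<open>rk :: 's \<Rightarrow> nat\<close>. Positions are lists over the positive naturals.\<close>

datatype 's tree = Node 's "'s tree list"

type_synonym pos = "nat list"

inductive_set trees :: "('s \<Rightarrow> nat) \<Rightarrow> 's tree set" for rk where
  "length ts = rk f \<Longrightarrow> \<forall>t\<in>set ts. t \<in> trees rk \<Longrightarrow> Node f ts \<in> trees rk"

definition maxrk :: "('s::finite \<Rightarrow> nat) \<Rightarrow> nat" where
  "maxrk rk = Max (range rk)"

fun is_pos :: "'s tree \<Rightarrow> pos \<Rightarrow> bool" where
  "is_pos t [] \<longleftrightarrow> True"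
| "is_pos (Node f ts) (i # w) \<longleftrightarrow> 1 \<le> i \<and> i \<le> length ts \<and> is_pos (ts ! (i - 1)) w"

definition positions :: "'s tree \<Rightarrow> pos set" where
  "positions t = {w. is_pos t w}"

fun lab :: "'s tree \<Rightarrow> pos \<Rightarrow> 's" where
  "lab (Node f ts) [] = f"
| "lab (Node f ts) (i # w) = lab (ts ! (i - 1)) w"


section \<open>Recognizable tree languages\<close>

record ('q, 's) fta =
  states :: "'q set"
  delta  :: "('q list \<times> 's \<times> 'q) set"
  final  :: "'q set"

definition is_fta :: "('s \<Rightarrow> nat) \<Rightarrow> ('q, 's) fta \<Rightarrow> bool" where
  "is_fta rk A \<longleftrightarrow> finite (states A) \<and> final A \<subseteq> states A \<and>
     (\<forall>(qs, f, q) \<in> delta A. length qs = rk f \<and> set qs \<subseteq> states A \<and> q \<in> states A)"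

inductive reaches :: "('q, 's) fta \<Rightarrow> 's tree \<Rightarrow> 'q \<Rightarrow> bool" for A where
  "(qs, f, q) \<in> delta A \<Longrightarrow> length ts = length qs \<Longrightarrow>
   \<forall>i < length ts. reaches A (ts ! i) (qs ! i) \<Longrightarrow> reaches A (Node f ts) q"

text \<open>State sets are finite subsets of \<open>nat\<close>; up to renaming of states this covers every finite
  automaton.\<close>

definition recognizable :: "('s \<Rightarrow> nat) \<Rightarrow> 's tree set \<Rightarrow> bool" where
  "recognizable rk L \<longleftrightarrow> (\<exists>A :: (nat, 's) fta. is_fta rk A \<and>
     L = {t \<in> trees rk. \<exists>q \<in> final A. reaches A t q})"


section \<open>Logics\<close>

text \<open>First-order variables range over \<open>'v\<close>, so that the variables indexed by positions which occur
  in branching transitive closures are available; second-order variables are natural numbers.\<close>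

datatype (dead 's, 'v) fm =
  FF
| Label 's 'v
| Edge nat 'v 'v
| Leq 'v 'v
| In 'v nat
| LenMod 'v nat nat  \<comment> \<open>\<open>LenMod x n m\<close> stands for \<open>|x| \<equiv>\<^sub>n m\<close>\<close>
| Neg "('s, 'v) fm"
| Conj "('s, 'v) fm" "('s, 'v) fm"
| Disj "('s, 'v) fm" "('s, 'v) fm"
| Ex1 'v "('s, 'v) fm"
| All1 'v "('s, 'v) fm"
| Ex2 nat "('s, 'v) fm"
| All2 nat "('s, 'v) fm"
for map: rename

primrec sat :: "'s tree \<Rightarrow> ('v \<Rightarrow> pos) \<Rightarrow> (nat \<Rightarrow> pos set) \<Rightarrow> ('s, 'v) fm \<Rightarrow> bool" where
  "sat t \<rho> S FF \<longleftrightarrow> False"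
| "sat t \<rho> S (Label f x) \<longleftrightarrow> lab t (\<rho> x) = f"
| "sat t \<rho> S (Edge i x y) \<longleftrightarrow> \<rho> y = \<rho> x @ [i]"
| "sat t \<rho> S (Leq x y) \<longleftrightarrow> prefix (\<rho> x) (\<rho> y)"
| "sat t \<rho> S (In x X) \<longleftrightarrow> \<rho> x \<in> S X"
| "sat t \<rho> S (LenMod x n m) \<longleftrightarrow> length (\<rho> x) mod n = m mod n"
| "sat t \<rho> S (Neg \<phi>) \<longleftrightarrow> \<not> sat t \<rho> S \<phi>"
| "sat t \<rho> S (Conj \<phi> \<psi>) \<longleftrightarrow> sat t \<rho> S \<phi> \<and> sat t \<rho> S \<psi>"
| "sat t \<rho> S (Disj \<phi> \<psi>) \<longleftrightarrow> sat t \<rho> S \<phi> \<or> sat t \<rho> S \<psi>"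
| "sat t \<rho> S (Ex1 x \<phi>) \<longleftrightarrow> (\<exists>v \<in> positions t. sat t (\<rho>(x := v)) S \<phi>)"
| "sat t \<rho> S (All1 x \<phi>) \<longleftrightarrow> (\<forall>v \<in> positions t. sat t (\<rho>(x := v)) S \<phi>)"
| "sat t \<rho> S (Ex2 X \<phi>) \<longleftrightarrow> (\<exists>V. V \<subseteq> positions t \<and> sat t \<rho> (S(X := V)) \<phi>)"
| "sat t \<rho> S (All2 X \<phi>) \<longleftrightarrow> (\<forall>V. V \<subseteq> positions t \<longrightarrow> sat t \<rho> (S(X := V)) \<phi>)"

primrec free1 :: "('s, 'v) fm \<Rightarrow> 'v set" where
  "free1 FF = {}"
| "free1 (Label f x) = {x}"
| "free1 (Edge i x y) = {x, y}"
| "free1 (Leq x y) = {x, y}"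
| "free1 (In x X) = {x}"
| "free1 (LenMod x n m) = {x}"
| "free1 (Neg \<phi>) = free1 \<phi>"
| "free1 (Conj \<phi> \<psi>) = free1 \<phi> \<union> free1 \<psi>"
| "free1 (Disj \<phi> \<psi>) = free1 \<phi> \<union> free1 \<psi>"
| "free1 (Ex1 x \<phi>) = free1 \<phi> - {x}"
| "free1 (All1 x \<phi>) = free1 \<phi> - {x}"
| "free1 (Ex2 X \<phi>) = free1 \<phi>"
| "free1 (All2 X \<phi>) = free1 \<phi>"

primrec free2 :: "('s, 'v) fm \<Rightarrow> nat set" where
  "free2 FF = {}"
| "free2 (Label f x) = {}"
| "free2 (Edge i x y) = {}"
| "free2 (Leq x y) = {}"
| "free2 (In x X) = {X}"
| "free2 (LenMod x n m) = {}"
| "free2 (Neg \<phi>) = free2 \<phi>"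
| "free2 (Conj \<phi> \<psi>) = free2 \<phi> \<union> free2 \<psi>"
| "free2 (Disj \<phi> \<psi>) = free2 \<phi> \<union> free2 \<psi>"
| "free2 (Ex1 x \<phi>) = free2 \<phi>"
| "free2 (All1 x \<phi>) = free2 \<phi>"
| "free2 (Ex2 X \<phi>) = free2 \<phi> - {X}"
| "free2 (All2 X \<phi>) = free2 \<phi> - {X}"

text \<open>The side conditions on the numerical parameters of the atoms.\<close>

primrec wf_fm :: "('s::finite \<Rightarrow> nat) \<Rightarrow> ('s, 'v) fm \<Rightarrow> bool" where
  "wf_fm rk FF \<longleftrightarrow> True"
| "wf_fm rk (Label f x) \<longleftrightarrow> True"
| "wf_fm rk (Edge i x y) \<longleftrightarrow> 1 \<le> i \<and> i \<le> maxrk rk"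
| "wf_fm rk (Leq x y) \<longleftrightarrow> True"
| "wf_fm rk (In x X) \<longleftrightarrow> True"
| "wf_fm rk (LenMod x n m) \<longleftrightarrow> 0 < n \<and> m < n"
| "wf_fm rk (Neg \<phi>) \<longleftrightarrow> wf_fm rk \<phi>"
| "wf_fm rk (Conj \<phi> \<psi>) \<longleftrightarrow> wf_fm rk \<phi> \<and> wf_fm rk \<psi>"
| "wf_fm rk (Disj \<phi> \<psi>) \<longleftrightarrow> wf_fm rk \<phi> \<and> wf_fm rk \<psi>"
| "wf_fm rk (Ex1 x \<phi>) \<longleftrightarrow> wf_fm rk \<phi>"
| "wf_fm rk (All1 x \<phi>) \<longleftrightarrow> wf_fm rk \<phi>"
| "wf_fm rk (Ex2 X \<phi>) \<longleftrightarrow> wf_fm rk \<phi>"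
| "wf_fm rk (All2 X \<phi>) \<longleftrightarrow> wf_fm rk \<phi>"

primrec mod_free :: "('s, 'v) fm \<Rightarrow> bool" where
  "mod_free FF \<longleftrightarrow> True"
| "mod_free (Label f x) \<longleftrightarrow> True"
| "mod_free (Edge i x y) \<longleftrightarrow> True"
| "mod_free (Leq x y) \<longleftrightarrow> True"
| "mod_free (In x X) \<longleftrightarrow> True"
| "mod_free (LenMod x n m) \<longleftrightarrow> False"
| "mod_free (Neg \<phi>) \<longleftrightarrow> mod_free \<phi>"
| "mod_free (Conj \<phi> \<psi>) \<longleftrightarrow> mod_free \<phi> \<and> mod_free \<psi>"
| "mod_free (Disj \<phi> \<psi>) \<longleftrightarrow> mod_free \<phi> \<and> mod_free \<psi>"
| "mod_free (Ex1 x \<phi>) \<longleftrightarrow> mod_free \<phi>"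
| "mod_free (All1 x \<phi>) \<longleftrightarrow> mod_free \<phi>"
| "mod_free (Ex2 X \<phi>) \<longleftrightarrow> mod_free \<phi>"
| "mod_free (All2 X \<phi>) \<longleftrightarrow> mod_free \<phi>"

primrec set_quantifier_free :: "('s, 'v) fm \<Rightarrow> bool" where
  "set_quantifier_free FF \<longleftrightarrow> True"
| "set_quantifier_free (Label f x) \<longleftrightarrow> True"
| "set_quantifier_free (Edge i x y) \<longleftrightarrow> True"
| "set_quantifier_free (Leq x y) \<longleftrightarrow> True"
| "set_quantifier_free (In x X) \<longleftrightarrow> True"
| "set_quantifier_free (LenMod x n m) \<longleftrightarrow> True"
| "set_quantifier_free (Neg \<phi>) \<longleftrightarrow> set_quantifier_free \<phi>"
| "set_quantifier_free (Conj \<phi> \<psi>) \<longleftrightarrow> set_quantifier_free \<phi> \<and> set_quantifier_free \<psi>"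
| "set_quantifier_free (Disj \<phi> \<psi>) \<longleftrightarrow> set_quantifier_free \<phi> \<and> set_quantifier_free \<psi>"
| "set_quantifier_free (Ex1 x \<phi>) \<longleftrightarrow> set_quantifier_free \<phi>"
| "set_quantifier_free (All1 x \<phi>) \<longleftrightarrow> set_quantifier_free \<phi>"
| "set_quantifier_free (Ex2 X \<phi>) \<longleftrightarrow> False"
| "set_quantifier_free (All2 X \<phi>) \<longleftrightarrow> False"

definition MSO :: "('s::finite \<Rightarrow> nat) \<Rightarrow> ('s, 'v) fm set" where
  "MSO rk = {\<phi>. wf_fm rk \<phi> \<and> mod_free \<phi>}"

definition FO_mod :: "('s::finite \<Rightarrow> nat) \<Rightarrow> ('s, 'v) fm set" where
  "FO_mod rk = {\<phi>. wf_fm rk \<phi> \<and> set_quantifier_free \<phi>}"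

text \<open>Satisfaction of sentences; the choice of the initial assignments is immaterial.\<close>

definition models :: "'s tree \<Rightarrow> ('s, 'v) fm \<Rightarrow> bool" where
  "models t \<phi> \<longleftrightarrow> sat t (\<lambda>_. []) (\<lambda>_. {}) \<phi>"

definition MSO_definable :: "('s::finite \<Rightarrow> nat) \<Rightarrow> 's tree set \<Rightarrow> bool" where
  "MSO_definable rk L \<longleftrightarrow> (\<exists>\<phi> :: ('s, nat) fm. \<phi> \<in> MSO rk \<and> free1 \<phi> = {} \<and> free2 \<phi> = {} \<and>
     L = {t \<in> trees rk. models t \<phi>})"

definition EA_definable :: "('s \<Rightarrow> nat) \<Rightarrow> ('s, nat) fm set \<Rightarrow> 's tree set \<Rightarrow> bool" where
  "EA_definable rk F L \<longleftrightarrow> (\<exists>\<theta> X x. \<theta> \<in> F \<and> free1 \<theta> \<subseteq> {x} \<and> free2 \<theta> \<subseteq> {X} \<and>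
     L = {t \<in> trees rk. models t (Ex2 X (All1 x \<theta>))})"


section \<open>Branching transitive closure\<close>

definition base :: "nat \<Rightarrow> pos \<Rightarrow> pos" where
  "base n v = (THE u. prefix u v \<and> n dvd length u \<and> length v - length u < n)"

lemma base_eq_take:
  assumes "0 < n"
  shows "base n v = take (n * (length v div n)) v"
  unfolding base_def
proof (rule the_equality)
  have *: "n * (length v div n) \<le> length v" by simp
  show "prefix (take (n * (length v div n)) v) v \<and> n dvd length (take (n * (length v div n)) v)
      \<and> length v - length (take (n * (length v div n)) v) < n"
    using assms * by (simp add: take_is_prefix min_absorb2 minus_mult_div_eq_mod)
next
  fix u assume u: "prefix u v \<and> n dvd length u \<and> length v - length u < n"
  then obtain k where k: "length u = n * k" by (auto elim: dvdE)
  from u obtain s where s: "v = u @ s" by (auto elim: prefixE)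
  with u k assms have "length v div n = k" by simp
  with k s show "u = take (n * (length v div n)) v" by simp
qed

text \<open>The relation \<open>\<psi>\<^sub>k(v, v\<^sub>1, \<dots>, v\<^sub>k)\<close>, where \<open>vs = [v\<^sub>1, \<dots>, v\<^sub>k]\<close>.\<close>

definition progress :: "nat \<Rightarrow> pos \<Rightarrow> pos list \<Rightarrow> bool" where
  "progress n v vs \<longleftrightarrow>
     (\<forall>v' \<in> set vs. prefix (base n v) (base n v') \<and> length (base n v') = length (base n v) + n) \<and>
     sorted_wrt (\<lambda>u u'. (u, u') \<in> lexord less_than) (map (base n) vs)"

text \<open>A family \<open>\<Phi>\<close> is given by \<open>m\<close> and the formulas \<open>\<Phi> 0, \<dots>, \<Phi> m\<close>; in \<open>\<Phi> k\<close>, the variable \<open>x\<close> is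
  \<open>0\<close> and \<open>y\<^sub>i\<close> is \<open>i\<close>.\<close>

definition is_family :: "('s, nat) fm set \<Rightarrow> nat \<Rightarrow> (nat \<Rightarrow> ('s, nat) fm) \<Rightarrow> bool" where
  "is_family F m \<Phi> \<longleftrightarrow> (\<forall>k \<le> m. \<Phi> k \<in> F \<and> free1 (\<Phi> k) \<subseteq> {0..k} \<and> free2 (\<Phi> k) = {})"

definition holds_at :: "'s tree \<Rightarrow> ('s, nat) fm \<Rightarrow> pos \<Rightarrow> pos list \<Rightarrow> bool" where
  "holds_at t \<phi> v vs \<longleftrightarrow>
     sat t (\<lambda>i. if i \<le> length vs then (v # vs) ! i else []) (\<lambda>_. {}) \<phi>"

definition progressing :: "('s \<Rightarrow> nat) \<Rightarrow> nat \<Rightarrow> nat \<Rightarrow> (nat \<Rightarrow> ('s, nat) fm) \<Rightarrow> bool" where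
  "progressing rk n m \<Phi> \<longleftrightarrow>
     (\<forall>k \<le> m. \<forall>t \<in> trees rk. \<forall>v \<in> positions t. \<forall>vs. length vs = k \<longrightarrow> set vs \<subseteq> positions t \<longrightarrow>
        holds_at t (\<Phi> k) v vs \<longrightarrow> progress n v vs)"

text \<open>\<open>XVar w\<close> is the variable \<open>x\<^sub>w\<close>. The formula \<open>\<phi>\<^sub>k(x\<^sub>w, x\<^sub>w\<^sub>1, \<dots>, x\<^sub>w\<^sub>k)\<close> is obtained from \<open>\<phi>\<^sub>k\<close> by an
  injective renaming of all (free and bound) variables, so no capture occurs; the auxiliary
  variables \<open>Aux j\<close> are the names of those bound variables that are not among \<open>x, y\<^sub>1, \<dots>, y\<^sub>k\<close>.\<close>

datatype btc_var = XVar pos | Aux nat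

definition inst :: "nat \<Rightarrow> pos \<Rightarrow> ('s, nat) fm \<Rightarrow> ('s, btc_var) fm" where
  "inst k w \<phi> =
     rename (\<lambda>j. if j = 0 then XVar w else if j \<le> k then XVar (w @ [j]) else Aux j) \<phi>"

definition big_disj :: "('s, 'v) fm list \<Rightarrow> ('s, 'v) fm" where
  "big_disj \<phi>s = foldr Disj \<phi>s FF"

definition big_conj :: "('s, 'v) fm list \<Rightarrow> ('s, 'v) fm" where
  "big_conj \<phi>s = foldr Conj \<phi>s (Neg FF)"

text \<open>All \<open>[l\<^sub>1, \<dots>, l\<^sub>k]\<close> of positive naturals with sum \<open>l\<close>.\<close>

definition compositions :: "nat \<Rightarrow> nat \<Rightarrow> nat list list" where
  "compositions l k = filter (\<lambda>ls. sum_list ls = l) (List.n_lists k [1..<Suc l])"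

lemma set_compositions:
  "set (compositions l k) = {ls. length ls = k \<and> (\<forall>a \<in> set ls. 0 < a) \<and> sum_list ls = l}"
proof -
  have "(set ls \<subseteq> {1..<Suc l} \<longleftrightarrow> (\<forall>a \<in> set ls. 0 < a))" if "sum_list ls = l" for ls :: "nat list"
    using member_le_sum_list[of _ ls] that by (fastforce simp: subset_eq)
  then show ?thesis
    unfolding compositions_def set_filter set_n_lists set_upt by blast
qed

text \<open>The formula \<open>BTC\<^sup>l\<^sub>w(\<Phi>)\<close> for \<open>l \<ge> 1\<close>; the equation for \<open>l = 0\<close> is a dummy.\<close>

function btc :: "nat \<Rightarrow> (nat \<Rightarrow> ('s, nat) fm) \<Rightarrow> nat \<Rightarrow> pos \<Rightarrow> ('s, btc_var) fm" where
  "btc m \<Phi> 0 w = FF"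
| "btc m \<Phi> (Suc 0) w = inst 0 w (\<Phi> 0)"
| "btc m \<Phi> (Suc (Suc l)) w =
     big_disj (map (\<lambda>k.
       foldr Ex1 (map (\<lambda>i. XVar (w @ [i])) [1..<Suc k])
         (Conj (inst k w (\<Phi> k))
           (big_disj (map (\<lambda>ls.
              big_conj (map (\<lambda>i. btc m \<Phi> (ls ! (i - 1)) (w @ [i])) [1..<Suc k]))
            (compositions (Suc l) k)))))
     [1..<Suc m])"
  by pat_completeness auto
termination
proof (relation "measure (\<lambda>(m, \<Phi>, l, w). l)")
  show "wf (measure (\<lambda>(m, \<Phi>, l, w). l))" by simp
next
  fix m :: nat and \<Phi> :: "nat \<Rightarrow> ('s, nat) fm" and l :: nat and w :: pos and k ls i
  assume "ls \<in> set (compositions (Suc l) k)" "i \<in> set [1..<Suc k]"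
  then have "sum_list ls = Suc l" "i - 1 < length ls"
    by (auto simp: set_compositions)
  then have "ls ! (i - 1) \<le> Suc l"
    using member_le_sum_list[of "ls ! (i - 1)" ls] nth_mem[of "i - 1" ls] by simp
  then show "((m, \<Phi>, ls ! (i - 1), w @ [i]), m, \<Phi>, Suc (Suc l), w)
      \<in> measure (\<lambda>(m, \<Phi>, l, w). l)" by simp
qed

definition btc_holds :: "'s tree \<Rightarrow> nat \<Rightarrow> (nat \<Rightarrow> ('s, nat) fm) \<Rightarrow> pos \<Rightarrow> bool" where
  "btc_holds t m \<Phi> v \<longleftrightarrow>
     (\<exists>l \<in> {1..card (positions t)}. sat t ((\<lambda>_. [])(XVar [] := v)) (\<lambda>_. {}) (btc m \<Phi> l []))"

definition BTC_definable :: "('s \<Rightarrow> nat) \<Rightarrow> ('s, nat) fm set \<Rightarrow> 's tree set \<Rightarrow> bool" where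
  "BTC_definable rk F L \<longleftrightarrow> (\<exists>m n \<Phi>. 0 < n \<and> is_family F m \<Phi> \<and> progressing rk n m \<Phi> \<and>
     L = {t \<in> trees rk. btc_holds t m \<Phi> []})"

end

theory Submission
  imports Defs "HOL-Library.List_Lexorder"
begin

text \<open>A run of an automaton with states below \<open>n\<close> is cut into blocks of height \<open>n\<close>, and the state at
  the root of a block is encoded by the depth of a position chosen inside the block; a single
  transition between blocks is then first-order definable with modulo atoms, which gives a
  branching transitive closure. Conversely, since successors in a progressing family lie in
  distinct blocks further down, a branching transitive closure amounts to the existence of one set
  of positions that contains the root and is locally closed under the family, an
  \<open>\<exists>\<forall>\<close>-condition. Modulo atoms are eliminated by quantifying over sets of positions, and MSO
  sentences are turned into automata by evaluating formulas in finite algebras, where set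
  quantifiers correspond to powersets.\<close>

section \<open>Positions and subtrees\<close>

text \<open>The delicate direction leads from automata to \<open>BTC_definable\<close>: the formulas
  of a family see only positions, so a state must be carried by the choice of a position. With
  states below \<open>n\<close>, the offset of a position from its base can name any state, but only
  if the block reaches offset \<open>n - 1\<close>. A block that does not has no block below it, so
  a run on it can be checked on the spot by a formula of bounded depth. Moreover the evaluation has
  to start at the root position itself, whose offset is fixed, so this position is allowed to stand
  for every final state. In passing from a closed set back to a closure, the danger is the bound on
  the evaluation by the size of the tree, since a position might be reached along several branches.
  Progress excludes this: strictly ordered bases of equal length are roots of disjoint
  subtrees.\<close>

fun subtree :: "'s tree \<Rightarrow> pos \<Rightarrow> 's tree" where
  "subtree t [] = t"
| "subtree (Node f ts) (i # w) = subtree (ts ! (i - 1)) w"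

lemma Nil_in_positions [simp]: "[] \<in> positions t"
  by (simp add: positions_def)

lemma Cons_in_positions_Node [simp]:
  "i # w \<in> positions (Node f ts) \<longleftrightarrow> 1 \<le> i \<and> i \<le> length ts \<and> w \<in> positions (ts ! (i - 1))"
  by (simp add: positions_def)

lemma positions_Node:
  "positions (Node f ts) = insert [] (\<Union>i<length ts. (#) (Suc i) ` positions (ts ! i))"
proof (intro set_eqI)
  fix p
  show "p \<in> positions (Node f ts)
      \<longleftrightarrow> p \<in> insert [] (\<Union>i<length ts. (#) (Suc i) ` positions (ts ! i))"
  proof (cases p)
    case (Cons j w)
    then show ?thesis by (cases j) auto
  qed simp
qed

lemma finite_positions [simp]: "finite (positions t)"
  by (induction t) (simp add: positions_Node)

lemma append_in_positions_iff:
  "u @ v \<in> positions t \<longleftrightarrow> u \<in> positions t \<and> v \<in> positions (subtree t u)"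
  by (induction t u rule: subtree.induct) auto

lemma positions_prefix: "v \<in> positions t \<Longrightarrow> prefix u v \<Longrightarrow> u \<in> positions t"
  by (auto simp: prefix_def append_in_positions_iff)

lemma lab_subtree: "u \<in> positions t \<Longrightarrow> lab (subtree t u) v = lab t (u @ v)"
  by (induction t u rule: subtree.induct) auto

lemma subtree_append: "subtree t (u @ v) = subtree (subtree t u) v"
  by (induction t u rule: subtree.induct) auto

lemma subtree_in_trees: "t \<in> trees rk \<Longrightarrow> u \<in> positions t \<Longrightarrow> subtree t u \<in> trees rk"
proof (induction t u rule: subtree.induct)
  case (2 f ts i w)
  then have "ts ! (i - 1) \<in> trees rk" by (auto elim!: trees.cases)
  with 2 show ?case by simp
qed simp

lemma child_in_positions_iff:
  assumes "t \<in> trees rk" "z \<in> positions t"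
  shows "z @ [i] \<in> positions t \<longleftrightarrow> 1 \<le> i \<and> i \<le> rk (lab t z)"
proof -
  obtain f ts where s: "subtree t z = Node f ts" by (cases "subtree t z")
  with subtree_in_trees[OF assms] have "length ts = rk f" by (auto elim: trees.cases)
  moreover have "lab t z = f" using lab_subtree[OF assms(2), of "[]"] s by simp
  ultimately show ?thesis using assms(2) s by (simp add: append_in_positions_iff)
qed

lemma subtree_unfold:
  assumes "t \<in> trees rk" "z \<in> positions t"
  shows "subtree t z = Node (lab t z) (map (\<lambda>i. subtree t (z @ [Suc i])) [0..<rk (lab t z)])"
proof -
  obtain f ts where s: "subtree t z = Node f ts" by (cases "subtree t z")
  with subtree_in_trees[OF assms] have "length ts = rk f" by (auto elim: trees.cases)
  moreover have "lab t z = f" using lab_subtree[OF assms(2), of "[]"] s by simp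
  ultimately show ?thesis using s by (auto simp: subtree_append intro!: nth_equalityI)
qed

lemma rk_le_maxrk: "rk f \<le> maxrk rk" for rk :: "'s::finite \<Rightarrow> nat"
  by (simp add: maxrk_def)

text \<open>Bounding child indices by \<open>maxrk\<close> leaves finitely many words of each
  length, which later turns statements about distances into finite disjunctions.\<close>

lemma set_position:
  fixes rk :: "'s::finite \<Rightarrow> nat"
  shows "t \<in> trees rk \<Longrightarrow> p \<in> positions t \<Longrightarrow> set p \<subseteq> {1..maxrk rk}"
proof (induction p rule: rev_induct)
  case (snoc i p)
  then have "p \<in> positions t" by (simp add: append_in_positions_iff)
  with snoc child_in_positions_iff[OF snoc.prems(1) this, of i] show ?case
    using rk_le_maxrk[of rk "lab t p"] by auto
qed simp

definition words :: "('s::finite \<Rightarrow> nat) \<Rightarrow> nat \<Rightarrow> pos set" where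
  "words rk j = {w. set w \<subseteq> {1..maxrk rk} \<and> length w = j}"

lemma finite_words [simp]: "finite (words rk j)"
  unfolding words_def by (rule finite_lists_length_eq) simp

section \<open>Base positions and induction over blocks\<close>

lemma base_eq_iff:
  assumes "0 < n"
  shows "base n v = u \<longleftrightarrow> prefix u v \<and> n dvd length u \<and> length v < length u + n"
proof
  assume u: "base n v = u"
  have *: "n * (length v div n) \<le> length v" by simp
  show "prefix u v \<and> n dvd length u \<and> length v < length u + n"
    using assms * u[symmetric]
    by (simp add: base_eq_take[OF assms] take_is_prefix min_absorb2)
      (metis dividend_less_times_div mult.commute add.commute)
next
  assume u: "prefix u v \<and> n dvd length u \<and> length v < length u + n"
  then obtain k where k: "length u = n * k" by (auto elim: dvdE)
  from u obtain s where s: "v = u @ s" by (auto elim: prefixE)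
  with u k assms have "length v div n = k" by simp
  with k s show "base n v = u" using assms by (simp add: base_eq_take)
qed

lemma prefix_base: "0 < n \<Longrightarrow> prefix (base n v) v"
  by (simp add: base_eq_take take_is_prefix)

lemma base_in_positions: "0 < n \<Longrightarrow> v \<in> positions t \<Longrightarrow> base n v \<in> positions t"
  by (rule positions_prefix[OF _ prefix_base])

lemma base_Nil [simp]: "0 < n \<Longrightarrow> base n [] = []"
  by (simp add: base_eq_take)

text \<open>Bottom-up induction over blocks: the claim may be used for all positions with a deeper
  base. The measure is the gap between the depth of the base and the height of the tree.\<close>

lemma positions_induct_base [consumes 2, case_names less]:
  assumes "0 < n" "v \<in> positions t"
    and "\<And>v. v \<in> positions t \<Longrightarrow>
      (\<And>v'. v' \<in> positions t \<Longrightarrow> length (base n v) < length (base n v') \<Longrightarrow> P v') \<Longrightarrow> P v"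
  shows "P v"
  using assms(2)
proof (induction "Max (length ` positions t) - length (base n v)" arbitrary: v rule: less_induct)
  case less
  show ?case
  proof (rule assms(3)[OF less.prems])
    fix v' assume v': "v' \<in> positions t" "length (base n v) < length (base n v')"
    have "length (base n v') \<le> Max (length ` positions t)"
      using base_in_positions[OF assms(1) v'(1)] by simp
    with v' show "P v'" by (intro less.hyps) auto
  qed
qed

section \<open>Recognizability of MSO-definable languages\<close>

text \<open>Lists of subtrees are indexed from 0 and children in positions from 1, hence
  \<open>Suc i\<close>.\<close>

definition sub :: "nat \<Rightarrow> ('a \<Rightarrow> pos set) \<Rightarrow> 'a \<Rightarrow> pos set" where
  "sub i \<alpha> v = {p. Suc i # p \<in> \<alpha> v}"

definition valid :: "'s tree \<Rightarrow> ('a \<Rightarrow> pos set) \<Rightarrow> bool" where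
  "valid t \<alpha> \<longleftrightarrow> (\<forall>v. \<alpha> v \<subseteq> positions t)"

text \<open>Such an \<open>h\<close> is a homomorphism into a finite algebra over symbols extended
  by one bit per variable, that is, a deterministic bottom-up automaton. Finiteness concerns the
  values that occur, not their type, and \<open>g\<close> takes lists of any length because ranks
  are not checked at this stage.\<close>

definition compositional :: "('s tree \<Rightarrow> ('a \<Rightarrow> pos set) \<Rightarrow> 'q) \<Rightarrow> bool" where
  "compositional h \<longleftrightarrow> finite (range (case_prod h)) \<and>
     (\<exists>g. \<forall>f ts \<alpha>. valid (Node f ts) \<alpha> \<longrightarrow>
        h (Node f ts) \<alpha> = g f (\<lambda>v. [] \<in> \<alpha> v) (map (\<lambda>i. h (ts ! i) (sub i \<alpha>)) [0..<length ts]))"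

text \<open>The values are fixed to be in \<open>nat\<close> because a definition cannot quantify
  over types; \<open>regularI\<close> lifts this restriction.\<close>

definition regular :: "('s tree \<Rightarrow> ('a \<Rightarrow> pos set) \<Rightarrow> bool) \<Rightarrow> bool" where
  "regular P \<longleftrightarrow> (\<exists>(h :: _ \<Rightarrow> _ \<Rightarrow> nat) F. compositional h \<and>
     (\<forall>t \<alpha>. valid t \<alpha> \<longrightarrow> P t \<alpha> = (h t \<alpha> \<in> F)))"

lemma valid_sub: "valid (Node f ts) \<alpha> \<Longrightarrow> i < length ts \<Longrightarrow> valid (ts ! i) (sub i \<alpha>)"
  unfolding valid_def sub_def by fastforce

lemma in_range_case_prod: "h t \<alpha> \<in> range (case_prod h)"
  by (rule range_eqI[of _ _ "(t, \<alpha>)"]) simp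

lemma compositionalI:
  assumes "finite (range (case_prod h))"
    and "\<And>f ts \<alpha>. valid (Node f ts) \<alpha> \<Longrightarrow>
      h (Node f ts) \<alpha> = g f (\<lambda>v. [] \<in> \<alpha> v) (map (\<lambda>i. h (ts ! i) (sub i \<alpha>)) [0..<length ts])"
  shows "compositional h"
  using assms unfolding compositional_def by blast

text \<open>The finitely many values of \<open>h\<close> embed into \<open>nat\<close>, and the
  algebra is conjugated by that embedding.\<close>

lemma regularI:
  fixes h :: "'s tree \<Rightarrow> ('a \<Rightarrow> pos set) \<Rightarrow> 'q"
  assumes h: "compositional h" and P: "\<And>t \<alpha>. valid t \<alpha> \<Longrightarrow> P t \<alpha> \<longleftrightarrow> h t \<alpha> \<in> F"
  shows "regular P"
proof -
  let ?R = "range (case_prod h)"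
  from h obtain g where fin: "finite ?R" and g: "\<And>f ts \<alpha>. valid (Node f ts) \<alpha> \<Longrightarrow>
      h (Node f ts) \<alpha> = g f (\<lambda>v. [] \<in> \<alpha> v) (map (\<lambda>i. h (ts ! i) (sub i \<alpha>)) [0..<length ts])"
    unfolding compositional_def by blast
  obtain e :: "'q \<Rightarrow> nat" where e: "inj_on e ?R"
    using finite_imp_inj_to_nat_seg[OF fin] by blast
  note R = in_range_case_prod[of h]
  have inv: "inv_into ?R e (e (h t \<alpha>)) = h t \<alpha>" for t \<alpha>
    using e R by (rule inv_into_f_f)
  have "compositional (\<lambda>t \<alpha>. e (h t \<alpha>))"
  proof (rule compositionalI[where g = "\<lambda>f b qs. e (g f b (map (inv_into ?R e) qs))"])
    have "range (\<lambda>(t, \<alpha>). e (h t \<alpha>)) = e ` ?R" by (auto simp: image_iff)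
    then show "finite (range (\<lambda>(t, \<alpha>). e (h t \<alpha>)))" using fin by simp
  qed (simp add: g inv comp_def)
  moreover have "P t \<alpha> \<longleftrightarrow> e (h t \<alpha>) \<in> e ` (F \<inter> ?R)" if "valid t \<alpha>" for t \<alpha>
    using P[OF that] inj_on_image_mem_iff[OF e R, of "F \<inter> ?R"] R by simp
  ultimately show ?thesis unfolding regular_def by blast
qed

lemma regular_cong:
  "regular P \<Longrightarrow> (\<And>t \<alpha>. valid t \<alpha> \<Longrightarrow> P t \<alpha> = Q t \<alpha>) \<Longrightarrow> regular Q"
  unfolding regular_def by metis

lemma regular_not:
  assumes "regular P" shows "regular (\<lambda>t \<alpha>. \<not> P t \<alpha>)"
proof -
  from assms obtain h :: "_ \<Rightarrow> _ \<Rightarrow> nat" and F where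
    h: "compositional h" "\<And>t \<alpha>. valid t \<alpha> \<Longrightarrow> P t \<alpha> \<longleftrightarrow> h t \<alpha> \<in> F"
    unfolding regular_def by blast
  then show ?thesis by (intro regularI[of h _ "- F"]) auto
qed

lemma compositional_pair:
  assumes "compositional h" "compositional k"
  shows "compositional (\<lambda>t \<alpha>. (h t \<alpha>, k t \<alpha>))"
proof -
  from assms obtain g g' where
    fin: "finite (range (case_prod h))" "finite (range (case_prod k))"
    and g: "\<And>f ts \<alpha>. valid (Node f ts) \<alpha> \<Longrightarrow>
      h (Node f ts) \<alpha> = g f (\<lambda>v. [] \<in> \<alpha> v) (map (\<lambda>i. h (ts ! i) (sub i \<alpha>)) [0..<length ts])"
     "\<And>f ts \<alpha>. valid (Node f ts) \<alpha> \<Longrightarrow>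
      k (Node f ts) \<alpha> = g' f (\<lambda>v. [] \<in> \<alpha> v) (map (\<lambda>i. k (ts ! i) (sub i \<alpha>)) [0..<length ts])"
    unfolding compositional_def by blast
  show ?thesis
  proof (rule compositionalI[where g = "\<lambda>f b qs. (g f b (map fst qs), g' f b (map snd qs))"])
    have "range (\<lambda>(t, \<alpha>). (h t \<alpha>, k t \<alpha>)) \<subseteq> range (case_prod h) \<times> range (case_prod k)"
      by (auto simp: image_iff)
    then show "finite (range (\<lambda>(t, \<alpha>). (h t \<alpha>, k t \<alpha>)))"
      by (rule finite_subset) (simp add: fin)
  qed (simp add: g comp_def)
qed

lemma regular_and:
  assumes "regular P" "regular Q" shows "regular (\<lambda>t \<alpha>. P t \<alpha> \<and> Q t \<alpha>)"
proof -
  from assms obtain h k :: "_ \<Rightarrow> _ \<Rightarrow> nat" and F G where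
    h: "compositional h" "\<And>t \<alpha>. valid t \<alpha> \<Longrightarrow> P t \<alpha> \<longleftrightarrow> h t \<alpha> \<in> F"
    and k: "compositional k" "\<And>t \<alpha>. valid t \<alpha> \<Longrightarrow> Q t \<alpha> \<longleftrightarrow> k t \<alpha> \<in> G"
    unfolding regular_def by blast
  then show ?thesis
    by (intro regularI[OF compositional_pair[OF h(1) k(1)], of _ "F \<times> G"]) auto
qed

lemma regular_or: "regular P \<Longrightarrow> regular Q \<Longrightarrow> regular (\<lambda>t \<alpha>. P t \<alpha> \<or> Q t \<alpha>)"
  by (rule regular_cong[OF regular_not[OF regular_and[OF regular_not[of P] regular_not[of Q]]]])
    simp_all

lemma sub_upd: "sub i (\<alpha>(v := V)) = (sub i \<alpha>)(v := {p. Suc i # p \<in> V})"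
  by (auto simp: sub_def fun_eq_iff)

lemma sub_empty: "sub i (\<lambda>_. {}) = (\<lambda>_. {})"
  by (simp add: sub_def fun_eq_iff)

text \<open>Projection is a powerset construction: the value collects the values of \<open>h\<close> over all choices
  of the quantified set, and choices in the subtrees are independent of each other.\<close>

lemma regular_ex:
  fixes P :: "'s tree \<Rightarrow> ('a \<Rightarrow> pos set) \<Rightarrow> bool"
  assumes "regular P" shows "regular (\<lambda>t \<alpha>. \<exists>V \<subseteq> positions t. P t (\<alpha>(v := V)))"
proof -
  from assms obtain h :: "_ \<Rightarrow> _ \<Rightarrow> nat" and F where
    h: "compositional h" and P: "\<And>t \<alpha>. valid t \<alpha> \<Longrightarrow> P t \<alpha> \<longleftrightarrow> h t \<alpha> \<in> F"
    unfolding regular_def by blast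
  from h obtain g where fin: "finite (range (case_prod h))" and g: "\<And>f ts \<alpha>. valid (Node f ts) \<alpha> \<Longrightarrow>
      h (Node f ts) \<alpha> = g f (\<lambda>v. [] \<in> \<alpha> v) (map (\<lambda>i. h (ts ! i) (sub i \<alpha>)) [0..<length ts])"
    unfolding compositional_def by blast
  define H where "H t \<alpha> = {h t (\<alpha>(v := V)) | V. V \<subseteq> positions t}" for t \<alpha>
  have "compositional H"
  \<comment> \<open>The powerset algebra picks one possible value for every child and guesses by
    \<open>c\<close> whether the root belongs to the quantified set.\<close>
  proof (rule compositionalI[where g = "\<lambda>f b Qs. {g f (b(v := c)) qs | c qs.
      length qs = length Qs \<and> (\<forall>i < length Qs. qs ! i \<in> Qs ! i)}"])
    have "range (case_prod H) \<subseteq> Pow (range (case_prod h))"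
      by (auto simp: H_def intro!: in_range_case_prod)
    then show "finite (range (case_prod H))" by (rule finite_subset) (simp add: fin)
  next
    fix f and ts :: "'s tree list" and \<alpha> :: "'a \<Rightarrow> pos set"
    assume \<alpha>: "valid (Node f ts) \<alpha>"
    have upd: "valid (Node f ts) (\<alpha>(v := V))" if "V \<subseteq> positions (Node f ts)" for V
      using \<alpha> that by (simp add: valid_def)
    have step: "h (Node f ts) (\<alpha>(v := V)) = g f ((\<lambda>x. [] \<in> \<alpha> x)(v := [] \<in> V))
        (map (\<lambda>i. h (ts ! i) ((sub i \<alpha>)(v := {p. Suc i # p \<in> V}))) [0..<length ts])"
      if "V \<subseteq> positions (Node f ts)" for V
    proof -
      have "(\<lambda>x. [] \<in> (\<alpha>(v := V)) x) = (\<lambda>x. [] \<in> \<alpha> x)(v := [] \<in> V)" by auto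
      then show ?thesis unfolding g[OF upd[OF that]] sub_upd by (rule arg_cong)
    qed
    let ?Qs = "map (\<lambda>i. H (ts ! i) (sub i \<alpha>)) [0..<length ts]"
    show "H (Node f ts) \<alpha> = {g f ((\<lambda>x. [] \<in> \<alpha> x)(v := c)) qs | c qs.
      length qs = length ?Qs \<and> (\<forall>i < length ?Qs. qs ! i \<in> ?Qs ! i)}" (is "_ = ?R")
    proof (intro equalityI subsetI)
      fix q assume "q \<in> H (Node f ts) \<alpha>"
      then obtain V where V: "V \<subseteq> positions (Node f ts)" "q = h (Node f ts) (\<alpha>(v := V))"
        by (auto simp: H_def)
      have *: "{p. Suc i # p \<in> V} \<subseteq> positions (ts ! i)" for i
      proof
        fix p assume "p \<in> {p. Suc i # p \<in> V}"
        then have "Suc i # p \<in> positions (Node f ts)" using V(1) by auto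
        then show "p \<in> positions (ts ! i)" by simp
      qed
      have mem: "h (ts ! i) ((sub i \<alpha>)(v := {p. Suc i # p \<in> V})) \<in> H (ts ! i) (sub i \<alpha>)" for i
        unfolding H_def using * by blast
      show "q \<in> ?R" unfolding V(2) step[OF V(1)]
        by (intro CollectI exI conjI, rule refl) (simp_all add: mem del: fun_upd_apply)
    next
      fix q assume "q \<in> ?R"
      then obtain c qs where q: "q = g f ((\<lambda>x. [] \<in> \<alpha> x)(v := c)) qs"
        and "length qs = length ?Qs" "\<forall>i < length ?Qs. qs ! i \<in> ?Qs ! i"
        by (elim CollectE exE conjE) (rule that)
      then have qs: "length qs = length ts" "\<forall>i < length ts. qs ! i \<in> H (ts ! i) (sub i \<alpha>)"
        by simp_all
      from qs(2) obtain W where W: "\<forall>i < length ts. W i \<subseteq> positions (ts ! i) \<and>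
          qs ! i = h (ts ! i) ((sub i \<alpha>)(v := W i))"
        unfolding H_def mem_Collect_eq by metis
      \<comment> \<open>The sets chosen in the subtrees and the bit at the root are glued into one
        set of positions of the whole tree.\<close>
      define V where "V = {p. p = [] \<and> c} \<union> (\<Union>i<length ts. (#) (Suc i) ` W i)"
      have V: "V \<subseteq> positions (Node f ts)" using W by (auto simp: V_def subset_eq)
      have Wi: "{p. Suc i # p \<in> V} = W i" if "i < length ts" for i
        using that by (auto simp: V_def)
      have c: "([] \<in> V) = c" by (auto simp: V_def)
      have "qs = map (\<lambda>i. h (ts ! i) ((sub i \<alpha>)(v := {p. Suc i # p \<in> V}))) [0..<length ts]"
        using W qs(1) by (intro nth_equalityI) (simp_all add: Wi del: fun_upd_apply)
      then have "q = h (Node f ts) (\<alpha>(v := V))" unfolding q step[OF V] c by (rule arg_cong)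
      with V show "q \<in> H (Node f ts) \<alpha>" unfolding H_def by blast
    qed
  qed
  then show ?thesis
  proof (rule regularI[where F = "{Q. Q \<inter> F \<noteq> {}}"])
    fix t :: "'s tree" and \<alpha> :: "'a \<Rightarrow> pos set" assume "valid t \<alpha>"
    then have "valid t (\<alpha>(v := V))" if "V \<subseteq> positions t" for V
      using that by (simp add: valid_def)
    with P show "(\<exists>V\<subseteq>positions t. P t (\<alpha>(v := V))) \<longleftrightarrow> H t \<alpha> \<in> {Q. Q \<inter> F \<noteq> {}}"
      unfolding H_def by blast
  qed
qed

section \<open>Algebras for the atomic formulas\<close>

lemma ex_valid_Node:
  assumes "valid (Node f ts) \<alpha>"
  shows "(\<exists>p \<in> \<alpha> v. P p) \<longleftrightarrow> [] \<in> \<alpha> v \<and> P [] \<or>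
    (\<exists>i < length ts. \<exists>p \<in> sub i \<alpha> v. P (Suc i # p))"
proof -
  have "\<alpha> v \<subseteq> positions (Node f ts)" using assms by (simp add: valid_def)
  then have "p = [] \<or> (\<exists>i < length ts. \<exists>q. p = Suc i # q)" if "p \<in> \<alpha> v" for p
    using that by (auto simp: positions_Node)
  then show ?thesis by (fastforce simp: sub_def)
qed

text \<open>Atoms are read as "some member of \<open>\<alpha> x\<close>" for arbitrary sets, because
  this reading splits into a disjunction over the root and the children. On singletons it is the
  intended atom.\<close>

lemma regular_label: "regular (\<lambda>t \<alpha>. \<exists>p \<in> \<alpha> x. lab t p = s)" (is "regular ?h")
proof (rule regularI[where h = ?h and F = "{True}"])
  show "compositional ?h"
    by (rule compositionalI[OF finite, where g = "\<lambda>f b qs. b x \<and> f = s \<or> (\<exists>i < length qs. qs ! i)"])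
      (simp add: ex_valid_Node cong: conj_cong)
qed simp

lemma regular_in: "regular (\<lambda>t \<alpha>. \<exists>p \<in> \<alpha> x. p \<in> \<alpha> y)" (is "regular ?h")
proof (rule regularI[where h = ?h and F = "{True}"])
  show "compositional ?h"
    by (rule compositionalI[OF finite, where g = "\<lambda>f b qs. b x \<and> b y \<or> (\<exists>i < length qs. qs ! i)"])
      (simp add: ex_valid_Node sub_def cong: conj_cong)
qed simp

text \<open>An edge that leaves the root ends at the root of a child, so the algebra also records
  whether the root of a subtree lies in \<open>\<alpha> y\<close>.\<close>

lemma regular_edge:
  "regular (\<lambda>t \<alpha>. \<exists>p \<in> \<alpha> x. p @ [Suc j] \<in> \<alpha> y)"
proof (rule regularI[where h = "\<lambda>t \<alpha>. ([] \<in> \<alpha> y, \<exists>p \<in> \<alpha> x. p @ [Suc j] \<in> \<alpha> y)" and F = "UNIV \<times> {True}"])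
  show "compositional (\<lambda>(t :: 'a tree) \<alpha>. ([] \<in> \<alpha> y, \<exists>p \<in> \<alpha> x. p @ [Suc j] \<in> \<alpha> y))"
  proof (rule compositionalI[OF finite, where g = "\<lambda>f b qs. (b y,
      b x \<and> j < length qs \<and> fst (qs ! j) \<or> (\<exists>i < length qs. snd (qs ! i)))"])
    fix f and ts :: "'a tree list" and \<alpha> :: "'b \<Rightarrow> pos set" assume val: "valid (Node f ts) \<alpha>"
    \<comment> \<open>Validity excludes an edge to a missing child, for which
      \<open>fst (qs ! j)\<close> would carry no information.\<close>
    from val have "j < length ts" if "[Suc j] \<in> \<alpha> y"
      using that by (auto simp: valid_def dest!: spec[of _ y])
    note 1 = val this
    let ?qs = "map (\<lambda>i. ([] \<in> sub i \<alpha> y, \<exists>p\<in>sub i \<alpha> x. p @ [Suc j] \<in> sub i \<alpha> y)) [0..<length ts]"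
    from 1 show "([] \<in> \<alpha> y, \<exists>p \<in> \<alpha> x. p @ [Suc j] \<in> \<alpha> y) = ([] \<in> \<alpha> y,
      [] \<in> \<alpha> x \<and> j < length ?qs \<and> fst (?qs ! j) \<or> (\<exists>i < length ?qs. snd (?qs ! i)))"
      by (simp add: ex_valid_Node sub_def cong: conj_cong) blast
  qed
qed auto

text \<open>Below the root every position is comparable with it, so when the root lies in
  \<open>\<alpha> x\<close> it only matters whether \<open>\<alpha> y\<close> is nonempty; the first
  component records this.\<close>

lemma regular_leq:
  "regular (\<lambda>t \<alpha>. \<exists>p \<in> \<alpha> x. \<exists>q \<in> \<alpha> y. prefix p q)"
proof (rule regularI[where h = "\<lambda>t \<alpha>. (\<exists>q \<in> \<alpha> y. True, \<exists>p \<in> \<alpha> x. \<exists>q \<in> \<alpha> y. prefix p q)"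
      and F = "UNIV \<times> {True}"])
  show "compositional (\<lambda>(t :: 'a tree) \<alpha>. (\<exists>q \<in> \<alpha> y. True, \<exists>p \<in> \<alpha> x. \<exists>q \<in> \<alpha> y. prefix p q))"
  proof (rule compositionalI[OF finite, where g = "\<lambda>f b qs. (b y \<or> (\<exists>i < length qs. fst (qs ! i)),
      b x \<and> (b y \<or> (\<exists>i < length qs. fst (qs ! i))) \<or> (\<exists>i < length qs. snd (qs ! i)))"])
    fix f and ts :: "'a tree list" and \<alpha> :: "'b \<Rightarrow> pos set" assume "valid (Node f ts) \<alpha>"
    note 1 = ex_valid_Node[OF this]
    let ?qs = "map (\<lambda>i. (\<exists>q \<in> sub i \<alpha> y. True, \<exists>p\<in>sub i \<alpha> x. \<exists>q \<in> sub i \<alpha> y. prefix p q)) [0..<length ts]"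
    have 2: "(\<exists>q \<in> \<alpha> y. prefix (Suc i # p) q) \<longleftrightarrow> (\<exists>q \<in> sub i \<alpha> y. prefix p q)"
      if "i < length ts" for i p
      using that by (auto simp: 1[of y])
    have 3: "(\<exists>q. q \<in> \<alpha> y) \<longleftrightarrow> [] \<in> \<alpha> y \<or> (\<exists>i < length ts. \<exists>q. q \<in> sub i \<alpha> y)"
      using 1[of y "\<lambda>_. True"] by simp
    show "(\<exists>q \<in> \<alpha> y. True, \<exists>p \<in> \<alpha> x. \<exists>q \<in> \<alpha> y. prefix p q) =
      ([] \<in> \<alpha> y \<or> (\<exists>i < length ?qs. fst (?qs ! i)),
      [] \<in> \<alpha> x \<and> ([] \<in> \<alpha> y \<or> (\<exists>i < length ?qs. fst (?qs ! i))) \<or> (\<exists>i < length ?qs. snd (?qs ! i)))"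
      unfolding 1[of x] by (simp add: 2 3 cong: conj_cong)
  qed
qed auto

text \<open>Counting up to 2 is enough to recognize cardinality 1, and truncation is compatible with
  adding the counts of the subtrees.\<close>

lemma regular_singleton: "regular (\<lambda>t \<alpha>. \<exists>p. \<alpha> x = {p})"
proof (rule regularI[where h = "\<lambda>t \<alpha>. min 2 (card (\<alpha> x))" and F = "{1}"])
  show "compositional (\<lambda>(t :: 'a tree) \<alpha>. min 2 (card (\<alpha> x)))"
  proof (rule compositionalI[where g = "\<lambda>f b qs. min 2 (of_bool (b x) + sum_list qs)"])
    have "range (\<lambda>(t, \<alpha>). min 2 (card (\<alpha> x))) \<subseteq> {..2}" by auto
    then show "finite (range (\<lambda>(t :: 'a tree, \<alpha>). min 2 (card (\<alpha> x))))"
      by (rule finite_subset) simp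
  next
    fix f and ts :: "'a tree list" and \<alpha> :: "'b \<Rightarrow> pos set" assume val: "valid (Node f ts) \<alpha>"
    then have x: "\<alpha> x \<subseteq> positions (Node f ts)" by (simp add: valid_def)
    then have "\<alpha> x = {p. p = [] \<and> [] \<in> \<alpha> x} \<union> (\<Union>i<length ts. (#) (Suc i) ` sub i \<alpha> x)"
      by (auto simp: positions_Node sub_def)
    moreover have fin: "finite (sub i \<alpha> x)" if "i < length ts" for i
      using valid_sub[OF val that] finite_subset finite_positions by (metis valid_def)
    have "card ({p. p = [] \<and> [] \<in> \<alpha> x} \<union> (\<Union>i<length ts. (#) (Suc i) ` sub i \<alpha> x)) =
      card {p :: pos. p = [] \<and> [] \<in> \<alpha> x} + card (\<Union>i<length ts. (#) (Suc i) ` sub i \<alpha> x)"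
      using fin by (intro card_Un_disjoint) auto
    moreover have "card (\<Union>i<length ts. (#) (Suc i) ` sub i \<alpha> x) =
        (\<Sum>i<length ts. card ((#) (Suc i) ` sub i \<alpha> x))"
      using fin by (intro card_UN_disjoint) auto
    moreover have "card ((#) (Suc i) ` sub i \<alpha> x) = card (sub i \<alpha> x)" for i
      by (intro card_image) simp
    moreover have "card {p :: pos. p = [] \<and> [] \<in> \<alpha> x} = of_bool ([] \<in> \<alpha> x)" by auto
    ultimately have "card (\<alpha> x) = of_bool ([] \<in> \<alpha> x) + (\<Sum>i<length ts. card (sub i \<alpha> x))"
      by presburger
    moreover have "min 2 (a + sum f {..<m}) = min 2 (a + sum_list (map (\<lambda>i. min 2 (f i)) [0..<m]))"
      for a m :: nat and f
      by (induction m) auto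
    ultimately show "min 2 (card (\<alpha> x)) = min 2 (of_bool ([] \<in> \<alpha> x) +
        sum_list (map (\<lambda>i. min 2 (card (sub i \<alpha> x))) [0..<length ts]))"
      by presburger
  qed
next
  fix t :: "'a tree" and \<alpha> :: "'b \<Rightarrow> pos set"
  show "(\<exists>p. \<alpha> x = {p}) = (min 2 (card (\<alpha> x)) \<in> {1})"
    unfolding card_1_singleton_iff[symmetric] by (simp add: min_def)
qed

text \<open>A first-order variable \<open>x\<close> becomes the set variable \<open>Inl x\<close> interpreted by a singleton.\<close>

definition represents ::
  "('s tree \<Rightarrow> ('v + nat \<Rightarrow> pos set) \<Rightarrow> bool) \<Rightarrow> ('s, 'v) fm \<Rightarrow> bool" where
  "represents P \<phi> \<longleftrightarrow> (\<forall>t \<rho> S \<alpha>. valid t \<alpha> \<longrightarrow> (\<forall>x \<in> free1 \<phi>. \<alpha> (Inl x) = {\<rho> x}) \<longrightarrow>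
     (\<forall>X \<in> free2 \<phi>. \<alpha> (Inr X) = S X) \<longrightarrow> P t \<alpha> = sat t \<rho> S \<phi>)"

lemma representsD:
  assumes "represents P \<phi>" "valid t \<alpha>" "\<And>x. x \<in> free1 \<phi> \<Longrightarrow> \<alpha> (Inl x) = {\<rho> x}"
    "\<And>X. X \<in> free2 \<phi> \<Longrightarrow> \<alpha> (Inr X) = S X"
  shows "P t \<alpha> = sat t \<rho> S \<phi>"
  using assms unfolding represents_def by blast

text \<open>The singleton test is left in the form
  \<open>(\<alpha>(Inl x := V)) (Inl x) = {p}\<close> so that the predicate is literally the one
  produced by \<open>regular_ex\<close> from \<open>regular_singleton\<close>.\<close>

lemma represents_ex1:
  fixes P :: "'s tree \<Rightarrow> ('v + nat \<Rightarrow> pos set) \<Rightarrow> bool"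
  assumes "represents P \<phi>"
  shows "represents (\<lambda>t \<alpha>. \<exists>V \<subseteq> positions t. (\<exists>p. (\<alpha>(Inl x := V)) (Inl x) = {p}) \<and>
    P t (\<alpha>(Inl x := V))) (Ex1 x \<phi>)"
  unfolding represents_def
proof (intro allI impI)
  fix t :: "'s tree" and \<rho> S \<alpha>
  assume \<alpha>: "valid t \<alpha>" "\<forall>y\<in>free1 (Ex1 x \<phi>). \<alpha> (Inl y) = {\<rho> y}"
    "\<forall>X\<in>free2 (Ex1 x \<phi>). \<alpha> (Inr X) = S X"
  have "P t (\<alpha>(Inl x := {p})) = sat t (\<rho>(x := p)) S \<phi>" if "p \<in> positions t" for p
    using \<alpha> that by (intro representsD[OF assms]) (auto simp: valid_def)
  then show "(\<exists>V\<subseteq>positions t. (\<exists>p. (\<alpha>(Inl x := V)) (Inl x) = {p}) \<and> P t (\<alpha>(Inl x := V))) =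
      sat t \<rho> S (Ex1 x \<phi>)"
    by (auto)
qed

lemma represents_ex2:
  fixes P :: "'s tree \<Rightarrow> ('v + nat \<Rightarrow> pos set) \<Rightarrow> bool"
  assumes "represents P \<phi>"
  shows "represents (\<lambda>t \<alpha>. \<exists>V \<subseteq> positions t. P t (\<alpha>(Inr X := V))) (Ex2 X \<phi>)"
  unfolding represents_def
proof (intro allI impI)
  fix t :: "'s tree" and \<rho> S \<alpha>
  assume \<alpha>: "valid t \<alpha>" "\<forall>y\<in>free1 (Ex2 X \<phi>). \<alpha> (Inl y) = {\<rho> y}"
    "\<forall>Y\<in>free2 (Ex2 X \<phi>). \<alpha> (Inr Y) = S Y"
  have "P t (\<alpha>(Inr X := V)) = sat t \<rho> (S(X := V)) \<phi>" if "V \<subseteq> positions t" for V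
    using \<alpha> that by (intro representsD[OF assms]) (auto simp: valid_def)
  then show "(\<exists>V\<subseteq>positions t. P t (\<alpha>(Inr X := V))) = sat t \<rho> S (Ex2 X \<phi>)"
    by auto
qed

text \<open>Both formulas have the same free variables and truth values, so universal quantifiers
  reduce to projection and complement.\<close>

lemma represents_all1: "represents P (Neg (Ex1 x (Neg \<phi>))) = represents P (All1 x \<phi>)"
  by (simp add: represents_def)

lemma represents_all2: "represents P (Neg (Ex2 X (Neg \<phi>))) = represents P (All2 X \<phi>)"
  by (simp add: represents_def)

lemma represents_neg: "represents P \<phi> \<Longrightarrow> represents (\<lambda>t \<alpha>. \<not> P t \<alpha>) (Neg \<phi>)"
  by (simp add: represents_def)

lemma represents_conj:
  fixes P Q :: "'s tree \<Rightarrow> ('v + nat \<Rightarrow> pos set) \<Rightarrow> bool"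
  assumes "represents P \<phi>" "represents Q \<psi>"
  shows "represents (\<lambda>t \<alpha>. P t \<alpha> \<and> Q t \<alpha>) (Conj \<phi> \<psi>)"
  unfolding represents_def
proof (intro allI impI)
  fix t :: "'s tree" and \<rho> S \<alpha>
  assume \<alpha>: "valid t \<alpha>" "\<forall>x\<in>free1 (Conj \<phi> \<psi>). \<alpha> (Inl x) = {\<rho> x}"
    "\<forall>X\<in>free2 (Conj \<phi> \<psi>). \<alpha> (Inr X) = S X"
  have "P t \<alpha> = sat t \<rho> S \<phi>" "Q t \<alpha> = sat t \<rho> S \<psi>"
    by (rule representsD[OF assms(1)] representsD[OF assms(2)]; use \<alpha> in simp)+
  then show "(P t \<alpha> \<and> Q t \<alpha>) = sat t \<rho> S (Conj \<phi> \<psi>)" by simp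
qed

lemma represents_disj:
  fixes P Q :: "'s tree \<Rightarrow> ('v + nat \<Rightarrow> pos set) \<Rightarrow> bool"
  assumes "represents P \<phi>" "represents Q \<psi>"
  shows "represents (\<lambda>t \<alpha>. P t \<alpha> \<or> Q t \<alpha>) (Disj \<phi> \<psi>)"
  unfolding represents_def
proof (intro allI impI)
  fix t :: "'s tree" and \<rho> S \<alpha>
  assume \<alpha>: "valid t \<alpha>" "\<forall>x\<in>free1 (Disj \<phi> \<psi>). \<alpha> (Inl x) = {\<rho> x}"
    "\<forall>X\<in>free2 (Disj \<phi> \<psi>). \<alpha> (Inr X) = S X"
  have "P t \<alpha> = sat t \<rho> S \<phi>" "Q t \<alpha> = sat t \<rho> S \<psi>"
    by (rule representsD[OF assms(1)] representsD[OF assms(2)]; use \<alpha> in simp)+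
  then show "(P t \<alpha> \<or> Q t \<alpha>) = sat t \<rho> S (Disj \<phi> \<psi>)" by simp
qed

lemma regular_mso:
  assumes "wf_fm rk \<phi>" "mod_free \<phi>"
  shows "\<exists>P. regular P \<and> represents P \<phi>"
  using assms
proof (induction \<phi>)
  case FF
  have "regular (\<lambda>t \<alpha>. False)"
    by (rule regularI[where h = "\<lambda>t \<alpha>. ()" and F = "{}"]) (auto intro!: compositionalI)
  then show ?case by (auto simp: represents_def)
next
  case (Label s x)
  show ?case by (rule exI, rule conjI, rule regular_label[of "Inl x" s]) (simp add: represents_def)
next
  case (Edge i x y)
  then obtain j where "i = Suc j" by (cases i) auto
  then show ?case
    by (intro exI[of _ "\<lambda>t \<alpha>. \<exists>p \<in> \<alpha> (Inl x). p @ [Suc j] \<in> \<alpha> (Inl y)"] conjI regular_edge)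
      (auto simp: represents_def)
next
  case (Leq x y)
  show ?case
    by (rule exI, rule conjI, rule regular_leq[of "Inl x" "Inl y"]) (simp add: represents_def)
next
  case (In x X)
  show ?case
    by (rule exI, rule conjI, rule regular_in[of "Inl x" "Inr X"]) (simp add: represents_def)
next
  case (Neg \<phi>)
  then obtain P where "regular P" "represents P \<phi>" by auto
  then show ?case
    by (intro exI[of _ "\<lambda>t \<alpha>. \<not> P t \<alpha>"] conjI regular_not represents_neg)
next
  case (Conj \<phi> \<psi>)
  then obtain P Q where "regular P" "represents P \<phi>" "regular Q" "represents Q \<psi>" by auto
  then show ?case
    by (intro exI[of _ "\<lambda>t \<alpha>. P t \<alpha> \<and> Q t \<alpha>"] conjI regular_and represents_conj)
next
  case (Disj \<phi> \<psi>)
  then obtain P Q where "regular P" "represents P \<phi>" "regular Q" "represents Q \<psi>" by auto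
  then show ?case
    by (intro exI[of _ "\<lambda>t \<alpha>. P t \<alpha> \<or> Q t \<alpha>"] conjI regular_or represents_disj)
next
  case (Ex1 x \<phi>)
  then obtain P where P: "regular P" "represents P \<phi>" by auto
  show ?case
    by (rule exI, rule conjI, rule regular_ex[OF regular_and[OF regular_singleton P(1)]])
      (rule represents_ex1[OF P(2)])
next
  case (All1 x \<phi>)
  then obtain P where P: "regular P" "represents P \<phi>" by auto
  show ?case
    by (rule exI, rule conjI,
        rule regular_not[OF regular_ex[OF regular_and[OF regular_singleton regular_not[OF P(1)]]]])
      (rule represents_neg[OF represents_ex1[OF represents_neg[OF P(2)]], unfolded represents_all1])
next
  case (Ex2 X \<phi>)
  then obtain P where P: "regular P" "represents P \<phi>" by auto
  show ?case
    by (rule exI, rule conjI, rule regular_ex[OF P(1)]) (rule represents_ex2[OF P(2)])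
next
  case (All2 X \<phi>)
  then obtain P where P: "regular P" "represents P \<phi>" by auto
  show ?case
    by (rule exI, rule conjI, rule regular_not[OF regular_ex[OF regular_not[OF P(1)]]])
      (rule represents_neg[OF represents_ex2[OF represents_neg[OF P(2)]], unfolded represents_all2])
qed simp

text \<open>For a sentence the algebra can be run on the empty assignment. The graph of
  \<open>g\<close> is then a deterministic automaton, and a tree over \<open>rk\<close> reaches
  exactly one state, its own value \<open>k t\<close>.\<close>

lemma mso_recognizable:
  assumes "wf_fm rk \<phi>" "mod_free \<phi>" "free1 \<phi> = {}" "free2 \<phi> = {}"
  shows "recognizable rk {t \<in> trees rk. models t \<phi>}"
proof -
  from regular_mso[OF assms(1,2)] obtain P where P: "regular P" "represents P \<phi>" by blast
  then obtain h :: "_ \<Rightarrow> _ \<Rightarrow> nat" and F where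
    h: "compositional h" and F: "\<And>t \<alpha>. valid t \<alpha> \<Longrightarrow> P t \<alpha> \<longleftrightarrow> h t \<alpha> \<in> F"
    unfolding regular_def by blast
  define k where "k t = h t (\<lambda>_. {})" for t
  define Q where "Q = range k"
  from h obtain g where fin: "finite (range (case_prod h))" and g: "\<And>f ts \<alpha>. valid (Node f ts) \<alpha> \<Longrightarrow>
      h (Node f ts) \<alpha> = g f (\<lambda>v. [] \<in> \<alpha> v) (map (\<lambda>i. h (ts ! i) (sub i \<alpha>)) [0..<length ts])"
    unfolding compositional_def by blast
  have k: "k (Node f ts) = g f (\<lambda>_. False) (map k ts)" for f ts
  proof -
    have "map (\<lambda>i. k (ts ! i)) [0..<length ts] = map k ts" by (rule nth_equalityI) simp_all
    then show ?thesis using g[of f ts "\<lambda>_. {}"] by (simp add: k_def valid_def sub_empty)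
  qed
  have "Q \<subseteq> range (case_prod h)" by (auto simp: Q_def k_def)
  then have Q: "finite Q" using fin by (rule finite_subset)
  define A where "A = \<lparr>states = Q, delta = {(qs, f, q). length qs = rk f \<and> set qs \<subseteq> Q \<and> q \<in> Q \<and>
    q = g f (\<lambda>_. False) qs}, final = F \<inter> Q\<rparr>"
  have fta: "is_fta rk A" using Q by (auto simp: is_fta_def A_def)
  have sound: "q = k t" if "reaches A t q" for t q
    using that
  proof induction
    case (1 qs f q ts)
    then have "qs = map k ts" by (intro nth_equalityI) auto
    with 1(1) show ?case by (simp add: A_def k)
  qed
  have complete: "reaches A t (k t)" if "t \<in> trees rk" for t
    using that
  proof induction
    case (1 ts f)
    then show ?case
      by (intro reaches.intros[of "map k ts"]) (auto simp: A_def k[symmetric] Q_def)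
  qed
  have "models t \<phi> \<longleftrightarrow> k t \<in> F" for t
    using representsD[OF P(2), of t "\<lambda>_. {}" "\<lambda>_. []" "\<lambda>_. {}"] F[of t "\<lambda>_. {}"] assms(3,4)
    by (simp add: models_def k_def valid_def)
  moreover have "(\<exists>q \<in> final A. reaches A t q) \<longleftrightarrow> k t \<in> F" if "t \<in> trees rk" for t
  proof -
    have "reaches A t q \<longleftrightarrow> q = k t" for q using sound complete[OF that] by blast
    moreover have "k t \<in> final A \<longleftrightarrow> k t \<in> F" by (simp add: A_def Q_def)
    ultimately show ?thesis by simp
  qed
  ultimately show ?thesis unfolding recognizable_def using fta by blast
qed

section \<open>Definable relations\<close>

lemma sat_cong:
  assumes "\<forall>x \<in> free1 \<phi>. \<rho> x = \<rho>' x" "\<forall>X \<in> free2 \<phi>. S X = S' X"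
  shows "sat t \<rho> S \<phi> = sat t \<rho>' S' \<phi>"
  using assms
proof (induction \<phi> arbitrary: \<rho> \<rho>' S S')
  case (Neg \<phi>)
  from Neg.IH[of \<rho> \<rho>' S S'] Neg.prems show ?case by simp
next
  case (Conj \<phi> \<psi>)
  from Conj.IH(1)[of \<rho> \<rho>' S S'] Conj.IH(2)[of \<rho> \<rho>' S S'] Conj.prems show ?case by simp
next
  case (Disj \<phi> \<psi>)
  from Disj.IH(1)[of \<rho> \<rho>' S S'] Disj.IH(2)[of \<rho> \<rho>' S S'] Disj.prems show ?case by simp
next
  case (Ex1 x \<phi>)
  have "sat t (\<rho>(x := v)) S \<phi> = sat t (\<rho>'(x := v)) S' \<phi>" for v
    using Ex1.prems by (intro Ex1.IH) auto
  then show ?case by simp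
next
  case (All1 x \<phi>)
  have "sat t (\<rho>(x := v)) S \<phi> = sat t (\<rho>'(x := v)) S' \<phi>" for v
    using All1.prems by (intro All1.IH) auto
  then show ?case by simp
next
  case (Ex2 X \<phi>)
  have "sat t \<rho> (S(X := V)) \<phi> = sat t \<rho>' (S'(X := V)) \<phi>" for V
    using Ex2.prems by (intro Ex2.IH) auto
  then show ?case by simp
next
  case (All2 X \<phi>)
  have "sat t \<rho> (S(X := V)) \<phi> = sat t \<rho>' (S'(X := V)) \<phi>" for V
    using All2.prems by (intro All2.IH) auto
  then show ?case by simp
qed auto

lemma sat_rename:
  assumes "inj g"
  shows "sat t \<rho> S (rename g \<phi>) = sat t (\<rho> \<circ> g) S \<phi>"
proof (induction \<phi> arbitrary: \<rho> S)
  case (Ex1 x \<phi>)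
  have "(\<rho>(g x := v)) \<circ> g = (\<rho> \<circ> g)(x := v)" for v
    using assms by (auto simp: fun_eq_iff inj_eq)
  then show ?case by (simp only: fm.map sat.simps Ex1.IH)
next
  case (All1 x \<phi>)
  have "(\<rho>(g x := v)) \<circ> g = (\<rho> \<circ> g)(x := v)" for v
    using assms by (auto simp: fun_eq_iff inj_eq)
  then show ?case by (simp only: fm.map sat.simps All1.IH)
qed simp_all

text \<open>A block of quantifiers becomes the choice of one modified assignment, which suits blocks
  whose length is a parameter.\<close>

lemma sat_foldr_Ex1:
  "sat t \<rho> S (foldr Ex1 xs \<phi>) \<longleftrightarrow>
    (\<exists>\<sigma>. (\<forall>x. x \<notin> set xs \<longrightarrow> \<sigma> x = \<rho> x) \<and> (\<forall>x \<in> set xs. \<sigma> x \<in> positions t) \<and> sat t \<sigma> S \<phi>)"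
proof (induction xs arbitrary: \<rho>)
  case Nil
  have "\<sigma> = \<rho>" if "\<forall>x. \<sigma> x = \<rho> x" for \<sigma> using that by auto
  then show ?case by auto
next
  case (Cons x xs)
  show ?case (is "?l = ?r")
  proof
    assume ?l
    then obtain v \<sigma> where "v \<in> positions t" "\<forall>y. y \<notin> set xs \<longrightarrow> \<sigma> y = (\<rho>(x := v)) y"
      "\<forall>x \<in> set xs. \<sigma> x \<in> positions t" "sat t \<sigma> S \<phi>"
      by (auto simp: Cons simp del: fun_upd_apply)
    then show ?r by (intro exI[of _ \<sigma>]) (auto split: if_splits)
  next
    assume ?r
    then obtain \<sigma> where \<sigma>: "\<forall>y. y \<notin> set (x # xs) \<longrightarrow> \<sigma> y = \<rho> y"
      "\<forall>y \<in> set (x # xs). \<sigma> y \<in> positions t" "sat t \<sigma> S \<phi>" by blast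
    then have "sat t (\<rho>(x := \<sigma> x)) S (foldr Ex1 xs \<phi>)"
      unfolding Cons by (intro exI[of _ \<sigma>]) auto
    then show ?l using \<sigma>(2) by auto
  qed
qed

lemma free_foldr_Ex1:
  "free1 (foldr Ex1 xs \<phi>) = free1 \<phi> - set xs" "free2 (foldr Ex1 xs \<phi>) = free2 \<phi>"
  by (induction xs) auto

text \<open>These are the closure properties that MSO and FO with modulo atoms share, so the
  constructions below are done once for both. Modulo atoms and set quantifiers are left out, as each
  belongs to only one of the two classes.\<close>

locale logic_class =
  fixes rk :: "'s::finite \<Rightarrow> nat" and F :: "('s, nat) fm set"
  assumes FF: "FF \<in> F"
    and Label: "Label f x \<in> F"
    and Edge: "1 \<le> i \<Longrightarrow> i \<le> maxrk rk \<Longrightarrow> Edge i x y \<in> F"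
    and Leq: "Leq x y \<in> F"
    and In: "In x X \<in> F"
    and Neg: "\<phi> \<in> F \<Longrightarrow> Neg \<phi> \<in> F"
    and Conj: "\<phi> \<in> F \<Longrightarrow> \<psi> \<in> F \<Longrightarrow> Conj \<phi> \<psi> \<in> F"
    and Disj: "\<phi> \<in> F \<Longrightarrow> \<psi> \<in> F \<Longrightarrow> Disj \<phi> \<psi> \<in> F"
    and Ex1: "\<phi> \<in> F \<Longrightarrow> Ex1 x \<phi> \<in> F"
    and All1: "\<phi> \<in> F \<Longrightarrow> All1 x \<phi> \<in> F"
begin

text \<open>Relations are combined in place of formulas. Agreement is asked only for trees over
  \<open>rk\<close> and assignments into positions, where child indices are bounded by
  \<open>maxrk\<close>.\<close>

definition definable ::
  "nat set \<Rightarrow> nat set \<Rightarrow> ('s tree \<Rightarrow> (nat \<Rightarrow> pos) \<Rightarrow> (nat \<Rightarrow> pos set) \<Rightarrow> bool) \<Rightarrow> bool" where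
  "definable V W P \<longleftrightarrow> (\<exists>\<phi> \<in> F. free1 \<phi> \<subseteq> V \<and> free2 \<phi> \<subseteq> W \<and>
     (\<forall>t \<in> trees rk. \<forall>\<rho> S. range \<rho> \<subseteq> positions t \<longrightarrow> sat t \<rho> S \<phi> = P t \<rho> S))"

lemma definableI:
  assumes "\<phi> \<in> F" "free1 \<phi> \<subseteq> V" "free2 \<phi> \<subseteq> W"
    "\<And>t \<rho> S. t \<in> trees rk \<Longrightarrow> range \<rho> \<subseteq> positions t \<Longrightarrow> sat t \<rho> S \<phi> = P t \<rho> S"
  shows "definable V W P"
  using assms unfolding definable_def by blast

lemma definable_mono:
  "definable V W P \<Longrightarrow> V \<subseteq> V' \<Longrightarrow> W \<subseteq> W' \<Longrightarrow>
   (\<And>t \<rho> S. t \<in> trees rk \<Longrightarrow> range \<rho> \<subseteq> positions t \<Longrightarrow> P t \<rho> S = Q t \<rho> S) \<Longrightarrow> definable V' W' Q"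
  unfolding definable_def by (elim bexE) (rule bexI, auto)

lemma definable_label: "x \<in> V \<Longrightarrow> definable V W (\<lambda>t \<rho> S. lab t (\<rho> x) = f)"
  by (rule definableI[of "Label f x"]) (auto intro: Label)

lemma definable_edge:
  "1 \<le> i \<Longrightarrow> i \<le> maxrk rk \<Longrightarrow> x \<in> V \<Longrightarrow> y \<in> V \<Longrightarrow> definable V W (\<lambda>t \<rho> S. \<rho> y = \<rho> x @ [i])"
  by (rule definableI[of "Edge i x y"]) (auto intro: Edge)

lemma definable_leq: "x \<in> V \<Longrightarrow> y \<in> V \<Longrightarrow> definable V W (\<lambda>t \<rho> S. prefix (\<rho> x) (\<rho> y))"
  by (rule definableI[of "Leq x y"]) (auto intro: Leq)

lemma definable_in: "x \<in> V \<Longrightarrow> X \<in> W \<Longrightarrow> definable V W (\<lambda>t \<rho> S. \<rho> x \<in> S X)"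
  by (rule definableI[of "In x X"]) (auto intro: In)

lemma definable_False: "definable V W (\<lambda>t \<rho> S. False)"
  by (rule definableI[of FF]) (auto intro: FF)

lemma definable_not: "definable V W P \<Longrightarrow> definable V W (\<lambda>t \<rho> S. \<not> P t \<rho> S)"
  unfolding definable_def by (elim bexE) (rule bexI[OF _ Neg], auto)

lemma definable_True: "definable V W (\<lambda>t \<rho> S. True)"
  using definable_not[OF definable_False] by simp

lemma definable_and:
  assumes "definable V W P" "definable V W Q"
  shows "definable V W (\<lambda>t \<rho> S. P t \<rho> S \<and> Q t \<rho> S)"
proof -
  from assms(1) obtain \<phi> where \<phi>: "\<phi> \<in> F" "free1 \<phi> \<subseteq> V" "free2 \<phi> \<subseteq> W"
    "\<And>t \<rho> S. t \<in> trees rk \<Longrightarrow> range \<rho> \<subseteq> positions t \<Longrightarrow> sat t \<rho> S \<phi> = P t \<rho> S"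
    unfolding definable_def by blast
  from assms(2) obtain \<psi> where \<psi>: "\<psi> \<in> F" "free1 \<psi> \<subseteq> V" "free2 \<psi> \<subseteq> W"
    "\<And>t \<rho> S. t \<in> trees rk \<Longrightarrow> range \<rho> \<subseteq> positions t \<Longrightarrow> sat t \<rho> S \<psi> = Q t \<rho> S"
    unfolding definable_def by blast
  from \<phi> \<psi> show ?thesis by (intro definableI[of "Conj \<phi> \<psi>"] Conj) simp_all
qed

lemma definable_or:
  assumes "definable V W P" "definable V W Q"
  shows "definable V W (\<lambda>t \<rho> S. P t \<rho> S \<or> Q t \<rho> S)"
proof -
  from assms(1) obtain \<phi> where \<phi>: "\<phi> \<in> F" "free1 \<phi> \<subseteq> V" "free2 \<phi> \<subseteq> W"
    "\<And>t \<rho> S. t \<in> trees rk \<Longrightarrow> range \<rho> \<subseteq> positions t \<Longrightarrow> sat t \<rho> S \<phi> = P t \<rho> S"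
    unfolding definable_def by blast
  from assms(2) obtain \<psi> where \<psi>: "\<psi> \<in> F" "free1 \<psi> \<subseteq> V" "free2 \<psi> \<subseteq> W"
    "\<And>t \<rho> S. t \<in> trees rk \<Longrightarrow> range \<rho> \<subseteq> positions t \<Longrightarrow> sat t \<rho> S \<psi> = Q t \<rho> S"
    unfolding definable_def by blast
  from \<phi> \<psi> show ?thesis by (intro definableI[of "Disj \<phi> \<psi>"] Disj) simp_all
qed

lemma definable_imp:
  assumes "definable V W P" "definable V W Q"
  shows "definable V W (\<lambda>t \<rho> S. P t \<rho> S \<longrightarrow> Q t \<rho> S)"
  using definable_or[OF definable_not[OF assms(1)] assms(2)] by simp

lemma definable_Bex:
  assumes "finite A" "\<And>a. a \<in> A \<Longrightarrow> definable V W (P a)"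
  shows "definable V W (\<lambda>t \<rho> S. \<exists>a \<in> A. P a t \<rho> S)"
  using assms by (induction A) (auto intro: definable_False definable_or)

lemma definable_Ball:
  assumes "finite A" "\<And>a. a \<in> A \<Longrightarrow> definable V W (P a)"
  shows "definable V W (\<lambda>t \<rho> S. \<forall>a \<in> A. P a t \<rho> S)"
  using assms by (induction A) (auto intro: definable_True definable_and)

text \<open>\<open>Q\<close> is given up to equivalence, so it can be written in any convenient form
  instead of with an updated assignment.\<close>

lemma definable_ex1:
  assumes "definable (insert x V) W P"
    "\<And>t \<rho> S. t \<in> trees rk \<Longrightarrow> range \<rho> \<subseteq> positions t \<Longrightarrow>
       Q t \<rho> S \<longleftrightarrow> (\<exists>v \<in> positions t. P t (\<rho>(x := v)) S)"
  shows "definable V W Q"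
proof -
  from assms(1) obtain \<phi> where \<phi>: "\<phi> \<in> F" "free1 \<phi> \<subseteq> insert x V" "free2 \<phi> \<subseteq> W"
    "\<And>t \<rho> S. t \<in> trees rk \<Longrightarrow> range \<rho> \<subseteq> positions t \<Longrightarrow> sat t \<rho> S \<phi> = P t \<rho> S"
    unfolding definable_def by blast
  have "sat t \<rho> S (Ex1 x \<phi>) = Q t \<rho> S" if "t \<in> trees rk" "range \<rho> \<subseteq> positions t" for t \<rho> S
  proof -
    have "range (\<rho>(x := v)) \<subseteq> positions t" if "v \<in> positions t" for v
      using \<open>range \<rho> \<subseteq> positions t\<close> that by auto
    then have "sat t (\<rho>(x := v)) S \<phi> = P t (\<rho>(x := v)) S" if "v \<in> positions t" for v
      using \<phi>(4) \<open>t \<in> trees rk\<close> that by blast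
    then show ?thesis using assms(2)[OF that] by simp
  qed
  then show ?thesis using \<phi> by (intro definableI[of "Ex1 x \<phi>"] Ex1) auto
qed

lemma definable_all1:
  assumes "definable (insert x V) W P"
    "\<And>t \<rho> S. t \<in> trees rk \<Longrightarrow> range \<rho> \<subseteq> positions t \<Longrightarrow>
       Q t \<rho> S \<longleftrightarrow> (\<forall>v \<in> positions t. P t (\<rho>(x := v)) S)"
  shows "definable V W Q"
proof -
  have "definable V W (\<lambda>t \<rho> S. \<not> Q t \<rho> S)"
    by (rule definable_ex1[OF definable_not[OF assms(1)]]) (simp add: assms(2))
  from definable_not[OF this] show ?thesis by simp
qed

lemma definable_ex_list:
  assumes "definable (V \<union> set xs) W P"
  shows "definable V W (\<lambda>t \<rho> S. \<exists>\<sigma>. (\<forall>x. x \<notin> set xs \<longrightarrow> \<sigma> x = \<rho> x) \<and>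
    (\<forall>x \<in> set xs. \<sigma> x \<in> positions t) \<and> P t \<sigma> S)"
proof -
  from assms(1) obtain \<phi> where \<phi>: "\<phi> \<in> F" "free1 \<phi> \<subseteq> V \<union> set xs" "free2 \<phi> \<subseteq> W"
    "\<And>t \<rho> S. t \<in> trees rk \<Longrightarrow> range \<rho> \<subseteq> positions t \<Longrightarrow> sat t \<rho> S \<phi> = P t \<rho> S"
    unfolding definable_def by blast
  show ?thesis
  proof (rule definableI[of "foldr Ex1 xs \<phi>"])
    show "foldr Ex1 xs \<phi> \<in> F" using \<phi>(1) by (induction xs) (auto intro: Ex1)
  next
    fix t and \<rho> :: "nat \<Rightarrow> pos" and S assume t: "t \<in> trees rk" and \<rho>: "range \<rho> \<subseteq> positions t"
    have "sat t \<sigma> S \<phi> = P t \<sigma> S"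
      if "\<forall>x. x \<notin> set xs \<longrightarrow> \<sigma> x = \<rho> x" "\<forall>x \<in> set xs. \<sigma> x \<in> positions t" for \<sigma>
    proof -
      have "\<sigma> x \<in> positions t" for x
        using that \<rho> by (cases "x \<in> set xs") auto
      then show ?thesis by (intro \<phi>(4)[OF t]) auto
    qed
    then show "sat t \<rho> S (foldr Ex1 xs \<phi>) \<longleftrightarrow> (\<exists>\<sigma>. (\<forall>x. x \<notin> set xs \<longrightarrow> \<sigma> x = \<rho> x) \<and>
      (\<forall>x \<in> set xs. \<sigma> x \<in> positions t) \<and> P t \<sigma> S)"
      unfolding sat_foldr_Ex1 by blast
  qed (use \<phi> in \<open>auto simp: free_foldr_Ex1\<close>)
qed

lemma definable_eq:
  assumes "x \<in> V" "y \<in> V" shows "definable V W (\<lambda>t \<rho> S. \<rho> x = \<rho> y)"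
  by (rule definable_mono[OF definable_and[OF definable_leq[OF assms] definable_leq[OF assms(2,1)]]])
    (auto intro: prefix_order.antisym)

text \<open>The root is the only position that is a prefix of all positions.\<close>

lemma definable_root:
  assumes "x \<in> V" shows "definable V W (\<lambda>t \<rho> S. \<rho> x = [])"
proof (rule definable_mono[of "{x}" W])
  show "definable {x} W (\<lambda>t \<rho> S. \<rho> x = [])"
    by (rule definable_all1[of "Suc x", OF definable_leq[of x _ "Suc x"]])
      (auto dest: bspec[of _ _ "[]"])
qed (use assms in auto)

text \<open>Each letter of \<open>w\<close> costs one bound variable for an intermediate position,
  which exists because positions are closed under prefixes.\<close>

lemma definable_path:
  assumes "set w \<subseteq> {1..maxrk rk}" "x \<in> V" "y \<in> V"
  shows "definable V W (\<lambda>t \<rho> S. \<rho> y = \<rho> x @ w)"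
  using assms
proof (induction w arbitrary: x V)
  case Nil
  then show ?case by (simp add: definable_eq)
next
  case (Cons i w)
  obtain z where z: "z \<notin> {x, y}"
    using ex_new_if_finite[of "{x, y}"] infinite_UNIV_nat by blast
  have "definable {x, y} W (\<lambda>t \<rho> S. \<rho> y = \<rho> x @ i # w)"
  proof (rule definable_ex1)
    show "definable (insert z {x, y}) W (\<lambda>t \<rho> S. \<rho> z = \<rho> x @ [i] \<and> \<rho> y = \<rho> z @ w)"
      using Cons.prems by (intro definable_and definable_edge Cons.IH) auto
  next
    fix t :: "'s tree" and \<rho> :: "nat \<Rightarrow> pos" and S :: "nat \<Rightarrow> pos set" assume "range \<rho> \<subseteq> positions t"
    then have "\<rho> y \<in> positions t" by auto
    then have "\<rho> x @ [i] \<in> positions t" if "\<rho> y = \<rho> x @ i # w"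
      using that positions_prefix[of "\<rho> y" t "\<rho> x @ [i]"] by simp
    then show "(\<rho> y = \<rho> x @ i # w) = (\<exists>v\<in>positions t.
      (\<rho>(z := v)) z = (\<rho>(z := v)) x @ [i] \<and> (\<rho>(z := v)) y = (\<rho>(z := v)) z @ w)"
      using z by auto
  qed
  then show ?case by (rule definable_mono) (use Cons.prems in auto)
qed

end

interpretation MSO: logic_class rk "MSO rk" for rk
  by unfold_locales (auto simp: MSO_def)

interpretation FO_mod: logic_class rk "FO_mod rk" for rk
  by unfold_locales (auto simp: FO_mod_def)

lemma FO_mod_length:
  assumes "x \<in> V" "q < n" shows "FO_mod.definable rk V W (\<lambda>t \<rho> S. length (\<rho> x) mod n = q)"
  by (rule FO_mod.definableI[of "LenMod x n q"]) (use assms in \<open>auto simp: FO_mod_def\<close>)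

section \<open>Elimination of modulo atoms\<close>

lemma MSO_all2:
  assumes "MSO.definable rk V (insert X W) P"
    "\<And>t \<rho> S. t \<in> trees rk \<Longrightarrow> range \<rho> \<subseteq> positions t \<Longrightarrow>
       Q t \<rho> S \<longleftrightarrow> (\<forall>Y. Y \<subseteq> positions t \<longrightarrow> P t \<rho> (S(X := Y)))"
  shows "MSO.definable rk V W Q"
proof -
  from assms(1) obtain \<phi> where \<phi>: "\<phi> \<in> MSO rk" "free1 \<phi> \<subseteq> V" "free2 \<phi> \<subseteq> insert X W"
    "\<And>t \<rho> S. t \<in> trees rk \<Longrightarrow> range \<rho> \<subseteq> positions t \<Longrightarrow> sat t \<rho> S \<phi> = P t \<rho> S"
    unfolding MSO.definable_def by blast
  then show ?thesis using assms(2) by (intro MSO.definableI[of "All2 X \<phi>"]) (auto simp: MSO_def)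
qed

lemma MSO_ex2:
  assumes "MSO.definable rk V (insert X W) P"
    "\<And>t \<rho> S. t \<in> trees rk \<Longrightarrow> range \<rho> \<subseteq> positions t \<Longrightarrow>
       Q t \<rho> S \<longleftrightarrow> (\<exists>Y. Y \<subseteq> positions t \<and> P t \<rho> (S(X := Y)))"
  shows "MSO.definable rk V W Q"
proof -
  have "MSO.definable rk V W (\<lambda>t \<rho> S. \<not> Q t \<rho> S)"
    by (rule MSO_all2[OF MSO.definable_not[OF assms(1)]]) (simp add: assms(2))
  from MSO.definable_not[OF this] show ?thesis by simp
qed

lemma append_word_iff:
  assumes "t \<in> trees rk" "v \<in> positions t"
  shows "(\<exists>w \<in> words rk n. v = u @ w) \<longleftrightarrow> prefix u v \<and> length v = length u + n"
proof
  assume "prefix u v \<and> length v = length u + n"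
  then obtain w where "v = u @ w" "length w = n" by (auto simp: prefix_def)
  moreover from this have "set w \<subseteq> {1..maxrk rk}" using set_position[OF assms] by simp
  ultimately show "\<exists>w \<in> words rk n. v = u @ w" by (auto simp: words_def)
qed (auto simp: words_def)

text \<open>A fixed distance is a finite disjunction over the words of that length, which is
  available in both logics.\<close>

lemma (in logic_class) definable_distance:
  assumes "x \<in> V" "y \<in> V"
  shows "definable V W (\<lambda>t \<rho> S. prefix (\<rho> x) (\<rho> y) \<and> length (\<rho> y) = length (\<rho> x) + n)"
proof (rule definable_mono[of V W "\<lambda>t \<rho> S. \<exists>w \<in> words rk n. \<rho> y = \<rho> x @ w"])
  show "definable V W (\<lambda>t \<rho> S. \<exists>w \<in> words rk n. \<rho> y = \<rho> x @ w)"
    using assms by (intro definable_Bex[OF finite_words] definable_path) (simp_all add: words_def)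
next
  fix t and \<rho> :: "nat \<Rightarrow> pos" assume "t \<in> trees rk" "range \<rho> \<subseteq> positions t"
  then show "(\<exists>w \<in> words rk n. \<rho> y = \<rho> x @ w) \<longleftrightarrow>
      prefix (\<rho> x) (\<rho> y) \<and> length (\<rho> y) = length (\<rho> x) + n"
    by (intro append_word_iff) auto
qed auto

lemma (in logic_class) definable_length:
  assumes "x \<in> V"
  shows "definable V W (\<lambda>t \<rho> S. length (\<rho> x) = n)"
proof (rule definable_mono[of "{x}" W])
  show "definable {x} W (\<lambda>t \<rho> S. length (\<rho> x) = n)"
    by (rule definable_ex1[of "Suc x" _ _ "\<lambda>t \<rho> S. \<rho> (Suc x) = [] \<and>
          prefix (\<rho> (Suc x)) (\<rho> x) \<and> length (\<rho> x) = length (\<rho> (Suc x)) + n"])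
      (auto intro!: definable_and[OF definable_root definable_distance])
qed (use assms in auto)

text \<open>A residue class is the least set of positions that contains depth \<open>m\<close> and
  is closed under descending by \<open>n\<close>; membership in a least closed set takes one
  universal set quantifier.\<close>

lemma all_closed_sets_iff:
  assumes "0 < n" "m < n" "p \<in> positions t"
  shows "length p mod n = m \<longleftrightarrow> (\<forall>Y. Y \<subseteq> positions t \<longrightarrow>
      (\<forall>v \<in> positions t. length v = m \<longrightarrow> v \<in> Y) \<longrightarrow>
      (\<forall>v \<in> positions t. v \<in> Y \<longrightarrow>
        (\<forall>u \<in> positions t. prefix v u \<and> length u = length v + n \<longrightarrow> u \<in> Y)) \<longrightarrow> p \<in> Y)"
    (is "_ \<longleftrightarrow> (\<forall>Y. ?A Y)")
proof
  assume "length p mod n = m"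
  then have len: "length p = m + length p div n * n" by (metis mod_div_mult_eq)
  show "\<forall>Y. ?A Y"
  proof (intro allI impI)
    fix Y assume Y: "\<forall>v \<in> positions t. length v = m \<longrightarrow> v \<in> Y"
      "\<forall>v \<in> positions t. v \<in> Y \<longrightarrow>
        (\<forall>u \<in> positions t. prefix v u \<and> length u = length v + n \<longrightarrow> u \<in> Y)"
    have "p \<in> Y" if "length p = m + k * n" "p \<in> positions t" for k p
      using that
    proof (induction k arbitrary: p)
      case 0
      then show ?case using Y(1) by simp
    next
      case (Suc k)
      \<comment> \<open>The ancestor \<open>n\<close> levels above \<open>p\<close>.\<close>
      let ?v = "take (m + k * n) p"
      have v: "?v \<in> positions t" using Suc.prems(2) take_is_prefix by (rule positions_prefix)
      moreover from this have "?v \<in> Y" using Suc.prems(1) by (intro Suc.IH) auto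
      moreover have "prefix ?v p" "length p = length ?v + n"
        using Suc.prems(1) by (auto simp: take_is_prefix)
      ultimately show ?case using Y(2) Suc.prems(2) by blast
    qed
    then show "p \<in> Y" using len assms(3) .
  qed
next
  assume "\<forall>Y. ?A Y"
  \<comment> \<open>The residue class itself is one of the closed sets.\<close>
  then have "?A {v \<in> positions t. length v mod n = m}" ..
  moreover have "length u mod n = m" if "length v mod n = m" "length u = length v + n" for u v :: pos
    using that by simp
  ultimately show "length p mod n = m" using assms by simp
qed

lemma MSO_length_mod:
  assumes "x \<in> V" "0 < n" "m < n"
  shows "MSO.definable rk V W (\<lambda>t \<rho> S. length (\<rho> x) mod n = m)"
proof (rule MSO.definable_mono[of rk "{x}" "{}"])
  let ?y = "Suc x" and ?z = "Suc (Suc x)"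
  have 1: "MSO.definable rk {x} {0} (\<lambda>t \<rho> S. \<forall>v \<in> positions t. length v = m \<longrightarrow> v \<in> S 0)"
    by (rule MSO.definable_all1[of _ ?y _ _ "\<lambda>t \<rho> S. length (\<rho> ?y) = m \<longrightarrow> \<rho> ?y \<in> S 0"])
      (auto intro!: MSO.definable_imp MSO.definable_length MSO.definable_in)
  have 2: "MSO.definable rk {x, ?y} {0} (\<lambda>t \<rho> S. \<rho> ?y \<in> S 0 \<longrightarrow>
      (\<forall>u \<in> positions t. prefix (\<rho> ?y) u \<and> length u = length (\<rho> ?y) + n \<longrightarrow> u \<in> S 0))"
    by (intro MSO.definable_imp MSO.definable_in, simp, simp,
        rule MSO.definable_all1[of _ ?z _ _ "\<lambda>t \<rho> S.
          prefix (\<rho> ?y) (\<rho> ?z) \<and> length (\<rho> ?z) = length (\<rho> ?y) + n \<longrightarrow> \<rho> ?z \<in> S 0"])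
      (auto intro!: MSO.definable_imp[OF MSO.definable_distance] MSO.definable_in)
  have 3: "MSO.definable rk {x} {0} (\<lambda>t \<rho> S. \<forall>v \<in> positions t. v \<in> S 0 \<longrightarrow>
      (\<forall>u \<in> positions t. prefix v u \<and> length u = length v + n \<longrightarrow> u \<in> S 0))"
    by (rule MSO.definable_all1[of _ ?y _ _ "(\<lambda>t \<rho> S. \<rho> ?y \<in> S 0 \<longrightarrow>
      (\<forall>u \<in> positions t. prefix (\<rho> ?y) u \<and> length u = length (\<rho> ?y) + n \<longrightarrow> u \<in> S 0))"])
      (use 2 in \<open>simp_all add: insert_commute\<close>)
  have x: "MSO.definable rk {x} {0} (\<lambda>t \<rho> S. \<rho> x \<in> S 0)"
    by (rule MSO.definable_in) auto
  show "MSO.definable rk {x} {} (\<lambda>t \<rho> S. length (\<rho> x) mod n = m)"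
    by (rule MSO_all2[OF MSO.definable_imp[OF 1 MSO.definable_imp[OF 3 x]]],
        subst all_closed_sets_iff[OF assms(2,3)]) auto
qed (use assms in auto)

lemma MSO_definable_FO_mod:
  assumes "\<phi> \<in> FO_mod rk"
  shows "MSO.definable rk (free1 \<phi>) (free2 \<phi>) (\<lambda>t \<rho> S. sat t \<rho> S \<phi>)"
  using assms
proof (induction \<phi>)
  case FF
  then show ?case by (simp add: MSO.definable_False)
next
  case (Label f x)
  show ?case by (simp add: MSO.definable_label)
next
  case (Edge i x y)
  then show ?case by (auto simp: FO_mod_def intro!: MSO.definable_edge)
next
  case (Leq x y)
  then show ?case by (simp add: MSO.definable_leq)
next
  case (In x X)
  then show ?case by (simp add: MSO.definable_in)
next
  case (LenMod x n m)
  then show ?case by (auto simp: FO_mod_def intro!: MSO_length_mod)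
next
  case (Neg \<phi>)
  then show ?case by (auto simp: FO_mod_def intro: MSO.definable_not)
next
  case (Conj \<phi> \<psi>)
  then have "MSO.definable rk (free1 \<phi> \<union> free1 \<psi>) (free2 \<phi> \<union> free2 \<psi>) (\<lambda>t \<rho> S. sat t \<rho> S \<phi>)"
    "MSO.definable rk (free1 \<phi> \<union> free1 \<psi>) (free2 \<phi> \<union> free2 \<psi>) (\<lambda>t \<rho> S. sat t \<rho> S \<psi>)"
    by (auto simp: FO_mod_def elim: MSO.definable_mono)
  then show ?case by (simp add: MSO.definable_and)
next
  case (Disj \<phi> \<psi>)
  then have "MSO.definable rk (free1 \<phi> \<union> free1 \<psi>) (free2 \<phi> \<union> free2 \<psi>) (\<lambda>t \<rho> S. sat t \<rho> S \<phi>)"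
    "MSO.definable rk (free1 \<phi> \<union> free1 \<psi>) (free2 \<phi> \<union> free2 \<psi>) (\<lambda>t \<rho> S. sat t \<rho> S \<psi>)"
    by (auto simp: FO_mod_def elim: MSO.definable_mono)
  then show ?case by (simp add: MSO.definable_or)
next
  case (Ex1 x \<phi>)
  then have "MSO.definable rk (insert x (free1 \<phi> - {x})) (free2 \<phi>) (\<lambda>t \<rho> S. sat t \<rho> S \<phi>)"
    by (auto simp: FO_mod_def elim: MSO.definable_mono)
  then show ?case unfolding free1.simps free2.simps by (rule MSO.definable_ex1) simp
next
  case (All1 x \<phi>)
  then have "MSO.definable rk (insert x (free1 \<phi> - {x})) (free2 \<phi>) (\<lambda>t \<rho> S. sat t \<rho> S \<phi>)"
    by (auto simp: FO_mod_def elim: MSO.definable_mono)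
  then show ?case unfolding free1.simps free2.simps by (rule MSO.definable_all1) simp
qed (auto simp: FO_mod_def)

section \<open>Branching transitive closures and closed sets of positions\<close>

lemma sat_big_disj: "sat t \<rho> S (big_disj \<phi>s) \<longleftrightarrow> (\<exists>\<phi> \<in> set \<phi>s. sat t \<rho> S \<phi>)"
  by (induction \<phi>s) (auto simp: big_disj_def)

lemma sat_big_conj: "sat t \<rho> S (big_conj \<phi>s) \<longleftrightarrow> (\<forall>\<phi> \<in> set \<phi>s. sat t \<rho> S \<phi>)"
  by (induction \<phi>s) (auto simp: big_conj_def)

text \<open>Passes between the two ways of supplying arguments to a member of a family: a list of
  positions and an assignment to the variables \<open>0\<close>, ..., \<open>k\<close>.\<close>

lemma holds_at_map:
  assumes "free1 \<phi> \<subseteq> {0..k}" "free2 \<phi> = {}"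
  shows "holds_at t \<phi> (\<sigma> 0) (map \<sigma> [1..<Suc k]) = sat t \<sigma> S \<phi>"
  unfolding holds_at_def
proof (rule sat_cong)
  show "\<forall>x \<in> free1 \<phi>. (if x \<le> length (map \<sigma> [1..<Suc k])
      then (\<sigma> 0 # map \<sigma> [1..<Suc k]) ! x else []) = \<sigma> x"
  proof
    fix x assume "x \<in> free1 \<phi>"
    with assms(1) have "x \<le> k" by auto
    then show "(if x \<le> length (map \<sigma> [1..<Suc k])
      then (\<sigma> 0 # map \<sigma> [1..<Suc k]) ! x else []) = \<sigma> x"
      by (cases x) (simp_all del: upt_Suc)
  qed
qed (use assms in simp)

lemma sat_inst:
  assumes "free1 \<phi> \<subseteq> {0..k}" "free2 \<phi> = {}"
  shows "sat t \<rho> S (inst k w \<phi>) =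
    holds_at t \<phi> (\<rho> (XVar w)) (map (\<lambda>i. \<rho> (XVar (w @ [i]))) [1..<Suc k])"
proof -
  define g where "g = (\<lambda>j. if j = 0 then XVar w else if j \<le> k then XVar (w @ [j]) else Aux j)"
  have "inj g" by (auto simp: inj_def g_def split: if_splits)
  then have "sat t \<rho> S (inst k w \<phi>) = sat t (\<rho> \<circ> g) S \<phi>"
    unfolding inst_def g_def[symmetric] by (rule sat_rename)
  also have "\<dots> = holds_at t \<phi> ((\<rho> \<circ> g) 0) (map (\<rho> \<circ> g) [1..<Suc k])"
    using assms by (rule holds_at_map[symmetric])
  also have "map (\<rho> \<circ> g) [1..<Suc k] = map (\<lambda>i. \<rho> (XVar (w @ [i]))) [1..<Suc k]"
    by (intro map_cong) (auto simp: g_def)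
  finally show ?thesis by (simp add: g_def)
qed

text \<open>The evaluation trees of a branching closure, freed from variable names. The index is the
  number of nodes, so a leaf (\<open>vs = []\<close>) has index 1.\<close>

inductive btc_tree :: "'s tree \<Rightarrow> nat \<Rightarrow> (nat \<Rightarrow> ('s, nat) fm) \<Rightarrow> nat \<Rightarrow> pos \<Rightarrow> bool" for t m \<Phi> where
  "holds_at t (\<Phi> (length vs)) v vs \<Longrightarrow> length vs \<le> m \<Longrightarrow> set vs \<subseteq> positions t \<Longrightarrow>
   length ls = length vs \<Longrightarrow> \<forall>i < length vs. btc_tree t m \<Phi> (ls ! i) (vs ! i) \<Longrightarrow>
   btc_tree t m \<Phi> (Suc (sum_list ls)) v"

lemma btc_tree_pos: "btc_tree t m \<Phi> l v \<Longrightarrow> 0 < l"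
  by (erule btc_tree.cases) simp

text \<open>Only the value of \<open>XVar w\<close> matters, since all variables further down are
  bound before they are read; hence the subformulas for different successors can share one
  assignment.\<close>

lemma sat_btc:
  assumes "is_family F m \<Phi>"
  shows "sat t \<rho> S (btc m \<Phi> l w) \<longleftrightarrow> btc_tree t m \<Phi> l (\<rho> (XVar w))"
  using assms
proof (induction m \<Phi> l w arbitrary: \<rho> S rule: btc.induct)
  case (1 m \<Phi> w)
  then show ?case using btc_tree_pos by fastforce
next
  case (2 m \<Phi> w)
  then have "free1 (\<Phi> 0) \<subseteq> {0..0}" "free2 (\<Phi> 0) = {}"
    unfolding is_family_def by blast+
  then have "sat t \<rho> S (btc m \<Phi> (Suc 0) w) = holds_at t (\<Phi> 0) (\<rho> (XVar w)) []"
    by (simp add: sat_inst)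
  also have "\<dots> = btc_tree t m \<Phi> (Suc 0) (\<rho> (XVar w))"
  proof
    assume "holds_at t (\<Phi> 0) (\<rho> (XVar w)) []"
    then show "btc_tree t m \<Phi> (Suc 0) (\<rho> (XVar w))"
      using btc_tree.intros[of t \<Phi> "[]" "\<rho> (XVar w)" m "[]"] by simp
  next
    assume "btc_tree t m \<Phi> (Suc 0) (\<rho> (XVar w))"
    then show "holds_at t (\<Phi> 0) (\<rho> (XVar w)) []"
    proof cases
      case (1 vs ls)
      \<comment> \<open>Any successor would contribute a positive index, but the sum of
        \<open>ls\<close> is 0 here.\<close>
      have "vs = []"
      proof (rule ccontr)
        assume "vs \<noteq> []"
        with 1 btc_tree_pos[of t m \<Phi> "ls ! 0" "vs ! 0"] have "0 < ls ! 0" "ls ! 0 \<in> set ls" by auto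
        then show False using 1(1) by auto
      qed
      with 1 show ?thesis by simp
    qed
  qed
  finally show ?case .
next
  case (3 m \<Phi> l w)
  define A where "A k = (\<lambda>i. XVar (w @ [i])) ` {1..<Suc k}" for k
  have fam: "free1 (\<Phi> k) \<subseteq> {0..k}" "free2 (\<Phi> k) = {}" if "k \<le> m" for k
    using 3(2) that by (auto simp: is_family_def)
  have IH: "sat t \<rho> S (btc m \<Phi> (ls ! (i - 1)) (w @ [i])) =
      btc_tree t m \<Phi> (ls ! (i - 1)) (\<rho> (XVar (w @ [i])))"
    if "k \<in> {1..<Suc m}" "ls \<in> set (compositions (Suc l) k)" "i \<in> {1..<Suc k}" for k ls i \<rho> S
    using that unfolding set_upt[symmetric] by (rule 3(1)[OF _ _ _ 3(2)])
  have "sat t \<rho> S (btc m \<Phi> (Suc (Suc l)) w) \<longleftrightarrow> (\<exists>k \<in> {1..<Suc m}. \<exists>\<sigma>.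
      (\<forall>x. x \<notin> A k \<longrightarrow> \<sigma> x = \<rho> x) \<and> (\<forall>x \<in> A k. \<sigma> x \<in> positions t) \<and>
      sat t \<sigma> S (inst k w (\<Phi> k)) \<and> (\<exists>ls \<in> set (compositions (Suc l) k). \<forall>i \<in> {1..<Suc k}.
        sat t \<sigma> S (btc m \<Phi> (ls ! (i - 1)) (w @ [i]))))"
    by (simp only: btc.simps sat_big_disj sat_big_conj sat_foldr_Ex1 sat.simps set_map set_upt
        bex_simps ball_simps A_def)
  also have "\<dots> \<longleftrightarrow> (\<exists>k \<in> {1..<Suc m}. \<exists>\<sigma>.
      (\<forall>x. x \<notin> A k \<longrightarrow> \<sigma> x = \<rho> x) \<and> (\<forall>x \<in> A k. \<sigma> x \<in> positions t) \<and>
      holds_at t (\<Phi> k) (\<rho> (XVar w)) (map (\<lambda>i. \<sigma> (XVar (w @ [i]))) [1..<Suc k]) \<and>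
      (\<exists>ls \<in> set (compositions (Suc l) k). \<forall>i \<in> {1..<Suc k}.
        btc_tree t m \<Phi> (ls ! (i - 1)) (\<sigma> (XVar (w @ [i])))))" (is "_ \<longleftrightarrow> ?r")
  proof (intro bex_cong refl ex_cong1 conj_cong ball_cong)
    fix k \<sigma> assume k: "k \<in> {1..<Suc m}" and "\<forall>x. x \<notin> A k \<longrightarrow> \<sigma> x = \<rho> x"
    moreover have "XVar w \<notin> A k" by (auto simp: A_def)
    ultimately have "\<sigma> (XVar w) = \<rho> (XVar w)" by blast
    then show "sat t \<sigma> S (inst k w (\<Phi> k)) = holds_at t (\<Phi> k) (\<rho> (XVar w))
        (map (\<lambda>i. \<sigma> (XVar (w @ [i]))) [1..<Suc k])"
      using sat_inst[OF fam] k by (simp del: upt_Suc)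
  qed (rule IH)
  also have "?r \<longleftrightarrow> btc_tree t m \<Phi> (Suc (Suc l)) (\<rho> (XVar w))"
  proof
    assume ?r
    then obtain k \<sigma> ls where k: "k \<in> {1..<Suc m}"
      and \<sigma>: "\<forall>x \<in> A k. \<sigma> x \<in> positions t"
        "holds_at t (\<Phi> k) (\<rho> (XVar w)) (map (\<lambda>i. \<sigma> (XVar (w @ [i]))) [1..<Suc k])"
      and ls: "ls \<in> set (compositions (Suc l) k)"
        "\<forall>i \<in> {1..<Suc k}. btc_tree t m \<Phi> (ls ! (i - 1)) (\<sigma> (XVar (w @ [i])))"
      by blast
    have "btc_tree t m \<Phi> (Suc (sum_list ls)) (\<rho> (XVar w))"
    proof (rule btc_tree.intros[of _ _ "map (\<lambda>i. \<sigma> (XVar (w @ [i]))) [1..<Suc k]"])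
      show "\<forall>i < length (map (\<lambda>i. \<sigma> (XVar (w @ [i]))) [1..<Suc k]).
          btc_tree t m \<Phi> (ls ! i) (map (\<lambda>i. \<sigma> (XVar (w @ [i]))) [1..<Suc k] ! i)"
        using ls(2) by (auto simp del: upt_Suc dest!: bspec[of _ _ "Suc _"])
    qed (use k \<sigma> ls(1) in \<open>auto simp: A_def set_compositions simp del: upt_Suc\<close>)
    then show "btc_tree t m \<Phi> (Suc (Suc l)) (\<rho> (XVar w))"
      using ls(1) by (simp add: set_compositions)
  next
    assume "btc_tree t m \<Phi> (Suc (Suc l)) (\<rho> (XVar w))"
    then show ?r
    proof cases
      case (1 vs ls)
      let ?k = "length vs"
      have k: "?k \<in> {1..<Suc m}" using 1 by (cases vs) auto
      have "0 < a" if "a \<in> set ls" for a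
        using that 1(5,6) btc_tree_pos by (fastforce simp: in_set_conv_nth)
      then have ls: "ls \<in> set (compositions (Suc l) ?k)" using 1(1,5) by (simp add: set_compositions)
      \<comment> \<open>Reassigns exactly the variables \<open>XVar (w @ [i])\<close> with
        \<open>1 \<le> i \<le> ?k\<close>, reading the \<open>i\<close>-th successor at list index
        \<open>i - 1\<close>.\<close>
      define \<sigma> where "\<sigma> x = (case x of
          XVar u \<Rightarrow> if u \<noteq> [] \<and> butlast u = w \<and> last u \<in> {1..<Suc ?k} then vs ! (last u - 1) else \<rho> x
        | Aux _ \<Rightarrow> \<rho> x)" for x
      have \<sigma>: "\<sigma> (XVar (w @ [i])) = vs ! (i - 1)" if "i \<in> {1..<Suc ?k}" for i
        using that by (simp add: \<sigma>_def)
      have \<sigma>': "\<sigma> x = \<rho> x" if "x \<notin> A ?k" for x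
      proof (cases x)
        case (XVar u)
        then show ?thesis using that by (cases u rule: rev_cases) (auto simp: \<sigma>_def A_def)
      qed (simp add: \<sigma>_def)
      have vs: "map (\<lambda>i. \<sigma> (XVar (w @ [i]))) [1..<Suc ?k] = vs"
        by (rule nth_equalityI) (simp_all add: \<sigma> del: upt_Suc)
      show ?r
      proof (intro bexI[OF _ k] exI[of _ \<sigma>] conjI allI impI ballI bexI[OF _ ls])
        show "\<sigma> x \<in> positions t" if "x \<in> A ?k" for x
        proof -
          from that obtain i where i: "x = XVar (w @ [i])" "i \<in> {1..<Suc ?k}" by (auto simp: A_def)
          then have "vs ! (i - 1) \<in> set vs" by (intro nth_mem) auto
          then show ?thesis using i \<sigma> 1(4) by auto
        qed
        show "holds_at t (\<Phi> ?k) (\<rho> (XVar w)) (map (\<lambda>i. \<sigma> (XVar (w @ [i]))) [1..<Suc ?k])"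
          unfolding vs by (rule 1(2))
        show "btc_tree t m \<Phi> (ls ! (i - 1)) (\<sigma> (XVar (w @ [i])))" if "i \<in> {1..<Suc ?k}" for i
          using that 1(6) \<sigma>[OF that] by (cases i) auto
      qed (rule \<sigma>')
    qed
  qed
  finally show ?case .
qed

text \<open>Support is local and nothing inductive is demanded; well-foundedness will come from
  progress. A condition of this form can be stated by one set quantifier followed by one first-order
  quantifier.\<close>

definition btc_closed :: "'s tree \<Rightarrow> nat \<Rightarrow> (nat \<Rightarrow> ('s, nat) fm) \<Rightarrow> pos set \<Rightarrow> bool" where
  "btc_closed t m \<Phi> X \<longleftrightarrow> X \<subseteq> positions t \<and>
    (\<forall>v \<in> X. \<exists>vs. length vs \<le> m \<and> set vs \<subseteq> X \<and> holds_at t (\<Phi> (length vs)) v vs)"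

lemma btc_closed_btc_tree: "btc_closed t m \<Phi> {v \<in> positions t. \<exists>l. btc_tree t m \<Phi> l v}"
  unfolding btc_closed_def
proof (intro conjI ballI)
  fix v assume "v \<in> {v \<in> positions t. \<exists>l. btc_tree t m \<Phi> l v}"
  then obtain l where "btc_tree t m \<Phi> l v" by blast
  then show "\<exists>vs. length vs \<le> m \<and> set vs \<subseteq> {v \<in> positions t. \<exists>l. btc_tree t m \<Phi> l v} \<and>
      holds_at t (\<Phi> (length vs)) v vs"
  proof cases
    case (1 vs ls)
    then show ?thesis by (intro exI[of _ vs]) (fastforce simp: in_set_conv_nth)
  qed
qed auto

text \<open>The bases of the successors of \<open>v\<close> are pairwise incomparable and strictly below the base
  of \<open>v\<close>, so the evaluation tree injects into the positions below that base.\<close>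

lemma btc_tree_of_btc_closed:
  assumes X: "btc_closed t m \<Phi> X" and prog: "progressing rk n m \<Phi>" and n: "0 < n"
    and t: "t \<in> trees rk" and v: "v \<in> X"
  shows "\<exists>l \<le> card {p \<in> positions t. prefix (base n v) p}. btc_tree t m \<Phi> l v"
proof -
  let ?B = "\<lambda>v. {p \<in> positions t. prefix (base n v) p}"
  have "v \<in> positions t" using X v by (auto simp: btc_closed_def)
  with n have "v \<in> X \<longrightarrow> (\<exists>l \<le> card (?B v). btc_tree t m \<Phi> l v)"
  proof (induction v rule: positions_induct_base)
    case (less v)
    show ?case
    proof
      assume "v \<in> X"
      with X obtain vs where vs: "length vs \<le> m" "set vs \<subseteq> X" "holds_at t (\<Phi> (length vs)) v vs"
        by (auto simp: btc_closed_def)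
      then have vs_pos: "set vs \<subseteq> positions t" using X by (auto simp: btc_closed_def)
      with vs prog t less(1) have "progress n v vs" unfolding progressing_def by blast
      then have below: "prefix (base n v) (base n u)" "length (base n u) = length (base n v) + n"
        if "u \<in> set vs" for u
        using that by (auto simp: progress_def)
      have sorted: "sorted_wrt (\<lambda>u u'. (u, u') \<in> lexord less_than) (map (base n) vs)"
        using \<open>progress n v vs\<close> by (simp add: progress_def)
      have "\<exists>l \<le> card (?B (vs ! i)). btc_tree t m \<Phi> l (vs ! i)" if "i < length vs" for i
      proof -
        from that have "vs ! i \<in> set vs" by simp
        moreover from this have "length (base n v) < length (base n (vs ! i))"
          using below(2) n by simp
        ultimately show ?thesis using less(2) vs(2) vs_pos by blast
      qed
      then obtain l where l: "i < length vs \<Longrightarrow> l i \<le> card (?B (vs ! i))"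
        "i < length vs \<Longrightarrow> btc_tree t m \<Phi> (l i) (vs ! i)" for i by metis
      have distinct: "base n (vs ! i) \<noteq> base n (vs ! j)" if "i < j" "j < length vs" for i j
        using sorted_wrt_nth_less[OF sorted that(1)] that lexord_irreflexive[of less_than] by auto
      \<comment> \<open>Two bases of equal length that are prefixes of one position coincide,
        whereas the strict order keeps them distinct.\<close>
      have disj: "?B (vs ! i) \<inter> ?B (vs ! j) = {}" if ij: "i < length vs" "j < length vs" "i \<noteq> j" for i j
      proof (rule ccontr)
        assume "?B (vs ! i) \<inter> ?B (vs ! j) \<noteq> {}"
        then obtain p where p: "prefix (base n (vs ! i)) p" "prefix (base n (vs ! j)) p" by auto
        have "length (base n (vs ! i)) = length (base n (vs ! j))" using below(2) ij by simp
        with p have "base n (vs ! i) = base n (vs ! j)" by (auto simp: prefix_def)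
        with distinct ij show False by (metis nat_neq_iff)
      qed
      let ?ls = "map l [0..<length vs]"
      have "sum_list ?ls = (\<Sum>i<length vs. l i)"
        by (simp add: sum_list_sum_nth lessThan_atLeast0)
      also have "\<dots> \<le> (\<Sum>i<length vs. card (?B (vs ! i)))" using l(1) by (intro sum_mono) simp
      also have "\<dots> = card (\<Union>i<length vs. ?B (vs ! i))"
        by (intro card_UN_disjoint[symmetric]) (simp_all add: disj)
      \<comment> \<open>The base of \<open>v\<close> lies below no base of a successor; leaving it
        out pays for the \<open>Suc\<close> of the root node of the evaluation tree.\<close>
      also have "\<dots> \<le> card (?B v - {base n v})"
      proof (intro card_mono subsetI)
        fix p assume "p \<in> (\<Union>i<length vs. ?B (vs ! i))"
        then obtain i where "i < length vs" "p \<in> ?B (vs ! i)" by blast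
        then obtain u where u: "u \<in> set vs" "p \<in> ?B u" using nth_mem by blast
        then have "length (base n v) < length p"
          using below(2)[OF u(1)] n prefix_length_le[of "base n u" p] by simp
        then show "p \<in> ?B v - {base n v}"
          using u below(1)[OF u(1)] by (auto intro: prefix_order.trans)
      qed simp
      also have "Suc \<dots> = card (?B v)"
        using base_in_positions[OF n less(1)] by (intro card_Suc_Diff1) simp_all
      finally have "Suc (sum_list ?ls) \<le> card (?B v)" by simp
      moreover have "btc_tree t m \<Phi> (Suc (sum_list ?ls)) v"
        using vs vs_pos l(2) by (intro btc_tree.intros[of _ _ vs]) simp_all
      ultimately show "\<exists>l \<le> card (?B v). btc_tree t m \<Phi> l v" by blast
    qed
  qed
  with v show ?thesis by blast
qed

text \<open>The root is its own base, so the bound of \<open>btc_tree_of_btc_closed\<close> becomes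
  the size bound built into \<open>btc_holds\<close>.\<close>

lemma btc_holds_iff:
  assumes "is_family F m \<Phi>" "progressing rk n m \<Phi>" "0 < n" "t \<in> trees rk"
  shows "btc_holds t m \<Phi> [] \<longleftrightarrow> (\<exists>X. btc_closed t m \<Phi> X \<and> [] \<in> X)"
proof
  assume "btc_holds t m \<Phi> []"
  then have "\<exists>l. btc_tree t m \<Phi> l []" by (auto simp: btc_holds_def sat_btc[OF assms(1)])
  then show "\<exists>X. btc_closed t m \<Phi> X \<and> [] \<in> X" using btc_closed_btc_tree by fastforce
next
  assume "\<exists>X. btc_closed t m \<Phi> X \<and> [] \<in> X"
  with assms(2-4) obtain l where "l \<le> card (positions t)" "btc_tree t m \<Phi> l []"
    using btc_tree_of_btc_closed[of t m \<Phi> _ rk n "[]"] by (auto simp: Collect_mem_eq)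
  moreover from this have "1 \<le> l" using btc_tree_pos by fastforce
  ultimately show "btc_holds t m \<Phi> []" by (auto simp: btc_holds_def sat_btc[OF assms(1)])
qed

section \<open>Translations between closures, \<exists>\<forall>-formulas and sentences\<close>

lemma ex_assignment_iff:
  assumes "free1 \<phi> \<subseteq> {0..k}" "free2 \<phi> = {}"
  shows "(\<exists>\<sigma>. (\<forall>x. x \<notin> set [1..<Suc k] \<longrightarrow> \<sigma> x = \<rho> x) \<and> (\<forall>x \<in> set [1..<Suc k]. \<sigma> x \<in> A) \<and>
      sat t \<sigma> S \<phi>) \<longleftrightarrow> (\<exists>vs. length vs = k \<and> set vs \<subseteq> A \<and> holds_at t \<phi> (\<rho> 0) vs)"
    (is "(\<exists>\<sigma>. ?P \<sigma>) \<longleftrightarrow> ?r")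
proof
  assume "\<exists>\<sigma>. ?P \<sigma>"
  then obtain \<sigma> where \<sigma>: "?P \<sigma>" ..
  then have "\<sigma> 0 = \<rho> 0" by simp
  then show ?r using \<sigma> holds_at_map[OF assms, of t \<sigma> S]
    by (intro exI[of _ "map \<sigma> [1..<Suc k]"]) (auto simp del: upt_Suc)
next
  assume ?r
  then obtain vs where vs: "length vs = k" "set vs \<subseteq> A" "holds_at t \<phi> (\<rho> 0) vs" by blast
  define \<sigma> where "\<sigma> i = (if i \<in> {1..<Suc k} then vs ! (i - 1) else \<rho> i)" for i
  have "map \<sigma> [1..<Suc k] = vs"
    using vs(1) by (intro nth_equalityI) (simp_all add: \<sigma>_def del: upt_Suc)
  moreover have "\<sigma> 0 = \<rho> 0" by (simp add: \<sigma>_def)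
  ultimately have "sat t \<sigma> S \<phi>" using holds_at_map[OF assms, of t \<sigma> S] vs(3) by simp
  moreover have "\<sigma> i \<in> A" if "i \<in> {1..<Suc k}" for i
  proof -
    have "vs ! (i - 1) \<in> set vs" using that vs(1) by (intro nth_mem) auto
    with vs(2) that show ?thesis by (auto simp: \<sigma>_def)
  qed
  ultimately show "\<exists>\<sigma>. ?P \<sigma>" by (intro exI[of _ \<sigma>]) (auto simp: \<sigma>_def simp del: upt_Suc)
qed

text \<open>The set quantifier guesses a closed set that contains the root. The argument uses only
  \<open>logic_class\<close>, so it serves both logics.\<close>

lemma (in logic_class) EA_definable_if_BTC_definable:
  assumes "BTC_definable rk F L" shows "EA_definable rk F L"
proof -
  from assms obtain m n \<Phi> where n: "0 < n" and fam: "is_family F m \<Phi>"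
    and prog: "progressing rk n m \<Phi>" and L: "L = {t \<in> trees rk. btc_holds t m \<Phi> []}"
    unfolding BTC_definable_def by blast
  have free: "\<Phi> k \<in> F" "free1 (\<Phi> k) \<subseteq> {0..k}" "free2 (\<Phi> k) = {}" if "k \<le> m" for k
    using fam that by (auto simp: is_family_def)
  let ?Q = "\<lambda>k t \<rho> S. \<exists>\<sigma>. (\<forall>x. x \<notin> set [1..<Suc k] \<longrightarrow> \<sigma> x = \<rho> x) \<and>
    (\<forall>x \<in> set [1..<Suc k]. \<sigma> x \<in> positions t) \<and>
    ((\<forall>i \<in> set [1..<Suc k]. \<sigma> i \<in> S 0) \<and> sat t \<sigma> S (\<Phi> k))"
  have Q: "definable {0} {0} (?Q k)" if "k \<in> {..m}" for k
  proof (intro definable_ex_list definable_and definable_Ball definable_in)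
    show "definable ({0} \<union> set [1..<Suc k]) {0} (\<lambda>t \<sigma> S. sat t \<sigma> S (\<Phi> k))"
      using that free[of k] by (intro definableI[of "\<Phi> k"]) fastforce+
  qed auto
  \<comment> \<open>That the root lies in \<open>X\<close> is phrased as a condition on the single
    quantified position. First- and second-order variables are named separately, so both can be
    number 0.\<close>
  define P where "P t \<rho> S \<longleftrightarrow> (\<rho> 0 = [] \<longrightarrow> \<rho> 0 \<in> S 0) \<and>
      (\<rho> 0 \<in> S 0 \<longrightarrow> (\<exists>k \<in> {..m}. ?Q k t \<rho> S))" for t \<rho> S
  have "definable {0} {0} P" unfolding P_def
    by (intro definable_and definable_imp definable_root definable_in definable_Bex Q) simp_all
  then obtain \<theta> where \<theta>: "\<theta> \<in> F" "free1 \<theta> \<subseteq> {0}" "free2 \<theta> \<subseteq> {0}"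
    and sat: "\<And>t \<rho> S. t \<in> trees rk \<Longrightarrow> range \<rho> \<subseteq> positions t \<Longrightarrow> sat t \<rho> S \<theta> \<longleftrightarrow> P t \<rho> S"
    unfolding definable_def by blast
  have "models t (Ex2 0 (All1 0 \<theta>)) \<longleftrightarrow> btc_holds t m \<Phi> []" if t: "t \<in> trees rk" for t
  proof -
    have "sat t ((\<lambda>_. [])(0 := v)) ((\<lambda>_. {})(0 := X)) \<theta> \<longleftrightarrow> (v = [] \<longrightarrow> v \<in> X) \<and>
        (v \<in> X \<longrightarrow> (\<exists>k \<in> {..m}. \<exists>vs. length vs = k \<and> set vs \<subseteq> X \<and> holds_at t (\<Phi> k) v vs))"
      if v: "v \<in> positions t" and X: "X \<subseteq> positions t" for v X
    proof -
      let ?\<rho> = "(\<lambda>_. [])(0 :: nat := v)" and ?S = "(\<lambda>_. {})(0 :: nat := X)"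
      have "?Q k t ?\<rho> ?S \<longleftrightarrow> (\<exists>vs. length vs = k \<and> set vs \<subseteq> X \<and> holds_at t (\<Phi> k) v vs)"
        if "k \<in> {..m}" for k
      proof -
        have "?Q k t ?\<rho> ?S \<longleftrightarrow> (\<exists>\<sigma>. (\<forall>x. x \<notin> set [1..<Suc k] \<longrightarrow> \<sigma> x = ?\<rho> x) \<and>
          (\<forall>x \<in> set [1..<Suc k]. \<sigma> x \<in> X) \<and> sat t \<sigma> ?S (\<Phi> k))"
          using X by (simp only: fun_upd_same) blast
        also have "\<dots> \<longleftrightarrow> (\<exists>vs. length vs = k \<and> set vs \<subseteq> X \<and> holds_at t (\<Phi> k) (?\<rho> 0) vs)"
          by (rule ex_assignment_iff) (use free that in auto)
        finally show ?thesis by simp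
      qed
      moreover have "range ?\<rho> \<subseteq> positions t" using v by auto
      ultimately show ?thesis using sat[OF t, of ?\<rho> ?S] by (simp add: P_def)
    qed
    then have "models t (Ex2 0 (All1 0 \<theta>)) \<longleftrightarrow> (\<exists>X. X \<subseteq> positions t \<and> (\<forall>v \<in> positions t.
        (v = [] \<longrightarrow> v \<in> X) \<and> (v \<in> X \<longrightarrow>
          (\<exists>k \<in> {..m}. \<exists>vs. length vs = k \<and> set vs \<subseteq> X \<and> holds_at t (\<Phi> k) v vs))))"
      by (simp add: models_def cong: conj_cong)
    also have "\<dots> \<longleftrightarrow> (\<exists>X. btc_closed t m \<Phi> X \<and> [] \<in> X)"
    proof -
      have "(\<exists>k \<in> {..m}. \<exists>vs. length vs = k \<and> set vs \<subseteq> X \<and> holds_at t (\<Phi> k) v vs) \<longleftrightarrow>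
        (\<exists>vs. length vs \<le> m \<and> set vs \<subseteq> X \<and> holds_at t (\<Phi> (length vs)) v vs)" for X v
        by blast
      then show ?thesis unfolding btc_closed_def by (intro ex_cong1) auto
    qed
    finally show ?thesis by (simp add: btc_holds_iff[OF fam prog n t])
  qed
  with L \<theta> show ?thesis unfolding EA_definable_def by blast
qed

text \<open>A family with \<open>m = 0\<close> has no successors and is evaluated once, at the root.
  A sentence does not depend on that position, and progress is vacuous with
  \<open>n = 1\<close>.\<close>

lemma BTC_definable_if_MSO_definable:
  fixes rk :: "'s::finite \<Rightarrow> nat"
  assumes "MSO_definable rk L" shows "BTC_definable rk (MSO rk) L"
proof -
  from assms obtain \<phi> :: "('s, nat) fm" where \<phi>: "\<phi> \<in> MSO rk" "free1 \<phi> = {}" "free2 \<phi> = {}"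
    and L: "L = {t \<in> trees rk. models t \<phi>}"
    unfolding MSO_definable_def by blast
  have fam: "is_family (MSO rk) 0 (\<lambda>_. \<phi>)" using \<phi> by (simp add: is_family_def)
  have prog: "progressing rk 1 0 (\<lambda>_. \<phi>)" by (simp add: progressing_def progress_def)
  have "holds_at t \<phi> v [] = models t \<phi>" for t v
    unfolding holds_at_def models_def by (rule sat_cong) (simp_all add: \<phi>)
  then have "btc_holds t 0 (\<lambda>_. \<phi>) [] \<longleftrightarrow> models t \<phi>" if "t \<in> trees rk" for t
    unfolding btc_holds_iff[OF fam prog zero_less_one that] btc_closed_def
    by (auto intro!: exI[of _ "{[]}"])
  with L fam prog show ?thesis unfolding BTC_definable_def
    by (intro exI[of _ 0] exI[of _ 1] exI[of _ "\<lambda>_. \<phi>"]) auto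
qed

lemma MSO_definable_if_EA_definable:
  fixes rk :: "'s::finite \<Rightarrow> nat"
  assumes "EA_definable rk (FO_mod rk) L" shows "MSO_definable rk L"
proof -
  from assms obtain \<theta> :: "('s, nat) fm" and X x
    where \<theta>: "\<theta> \<in> FO_mod rk" "free1 \<theta> \<subseteq> {x}" "free2 \<theta> \<subseteq> {X}"
    and L: "L = {t \<in> trees rk. models t (Ex2 X (All1 x \<theta>))}"
    unfolding EA_definable_def by blast
  have "MSO.definable rk (insert x {}) (insert X {}) (\<lambda>t \<rho> S. sat t \<rho> S \<theta>)"
    by (rule MSO.definable_mono[OF MSO_definable_FO_mod[OF \<theta>(1)] \<theta>(2,3)]) simp
  then have "MSO.definable rk {} (insert X {}) (\<lambda>t \<rho> S. sat t \<rho> S (All1 x \<theta>))"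
    by (rule MSO.definable_all1) simp
  then have "MSO.definable rk {} {} (\<lambda>t \<rho> S. sat t \<rho> S (Ex2 X (All1 x \<theta>)))"
    by (rule MSO_ex2) simp
  then obtain \<phi> where \<phi>: "\<phi> \<in> MSO rk" "free1 \<phi> \<subseteq> {}" "free2 \<phi> \<subseteq> {}"
    and "\<And>t \<rho> S. t \<in> trees rk \<Longrightarrow> range \<rho> \<subseteq> positions t \<Longrightarrow>
      sat t \<rho> S \<phi> = sat t \<rho> S (Ex2 X (All1 x \<theta>))"
    unfolding MSO.definable_def by blast
  then have "models t \<phi> = models t (Ex2 X (All1 x \<theta>))" if "t \<in> trees rk" for t
    using that unfolding models_def by simp
  with \<phi> L show ?thesis unfolding MSO_definable_def by (intro exI[of _ \<phi>]) auto
qed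

section \<open>Recognizable languages are BTC-definable\<close>

text \<open>A partial run through \<open>d\<close> levels below \<open>z\<close>, with
  \<open>R\<close> prescribing the states allowed at the frontier. Branches that end earlier are
  closed by transitions of rank 0, so an unsatisfiable \<open>R\<close> demands a complete run on a
  subtree of height less than \<open>d\<close>.\<close>

primrec evals :: "('q, 's) fta \<Rightarrow> 's tree \<Rightarrow> (pos \<Rightarrow> 'q \<Rightarrow> bool) \<Rightarrow> nat \<Rightarrow> pos \<Rightarrow> 'q \<Rightarrow> bool" where
  "evals A t R 0 z q \<longleftrightarrow> R z q"
| "evals A t R (Suc d) z q \<longleftrightarrow> (\<exists>(qs, f, p) \<in> delta A. p = q \<and> lab t z = f \<and>
     (\<forall>i \<in> {..<length qs}. z @ [Suc i] \<in> positions t \<and> evals A t R d (z @ [Suc i]) (qs ! i)))"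

lemma evals_sound:
  assumes A: "is_fta rk A" and t: "t \<in> trees rk"
  shows "z \<in> positions t \<Longrightarrow> evals A t R d z q \<Longrightarrow>
    (\<And>z' q'. z' \<in> positions t \<Longrightarrow> prefix z z' \<Longrightarrow> length z' = length z + d \<Longrightarrow> R z' q' \<Longrightarrow>
       reaches A (subtree t z') q') \<Longrightarrow> reaches A (subtree t z) q"
proof (induction d arbitrary: z q)
  case 0
  then show ?case by simp
next
  case (Suc d)
  from Suc.prems(2) obtain qs where qs: "(qs, lab t z, q) \<in> delta A"
    and sub: "\<And>i. i < length qs \<Longrightarrow> z @ [Suc i] \<in> positions t"
      "\<And>i. i < length qs \<Longrightarrow> evals A t R d (z @ [Suc i]) (qs ! i)" by auto
  from A qs have len: "length qs = rk (lab t z)" by (auto simp: is_fta_def)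
  have "reaches A (subtree t (z @ [Suc i])) (qs ! i)" if "i < length qs" for i
  proof (rule Suc.IH[OF sub(1,2)[OF that]])
    fix z' q' assume "z' \<in> positions t" "prefix (z @ [Suc i]) z'"
      "length z' = length (z @ [Suc i]) + d" "R z' q'"
    then show "reaches A (subtree t z') q'" by (intro Suc.prems(3)) (auto dest: append_prefixD)
  qed
  then show ?case unfolding subtree_unfold[OF t Suc.prems(1)]
    by (intro reaches.intros[OF qs]) (simp_all add: len)
qed

text \<open>A run commits to one state per position, which makes the states encoded in neighbouring
  blocks fit together; \<open>reaches\<close> alone gives no such common choice.\<close>

definition is_run :: "('q, 's) fta \<Rightarrow> 's tree \<Rightarrow> (pos \<Rightarrow> 'q) \<Rightarrow> bool" where
  "is_run A t r \<longleftrightarrow> (\<forall>p \<in> positions t. \<exists>qs. (qs, lab t p, r p) \<in> delta A \<and>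
     (\<forall>i < length qs. qs ! i = r (p @ [Suc i])))"

lemma reaches_imp_run: "reaches A t q \<Longrightarrow> \<exists>r. r [] = q \<and> is_run A t r"
proof (induction rule: reaches.induct)
  case (1 qs f q ts)
  then obtain r where r: "\<And>i. i < length ts \<Longrightarrow> r i [] = qs ! i"
    "\<And>i. i < length ts \<Longrightarrow> is_run A (ts ! i) (r i)" by metis
  define s where "s p = (case p of [] \<Rightarrow> q | i # w \<Rightarrow> r (i - 1) w)" for p
  have "is_run A (Node f ts) s"
    unfolding is_run_def
  proof
    fix p assume p: "p \<in> positions (Node f ts)"
    show "\<exists>ps. (ps, lab (Node f ts) p, s p) \<in> delta A \<and> (\<forall>i<length ps. ps ! i = s (p @ [Suc i]))"
    proof (cases p)
      case Nil
      then show ?thesis using 1(1,2) r(1) by (intro exI[of _ qs]) (simp add: s_def)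
    next
      case (Cons i w)
      with p have "is_run A (ts ! (i - 1)) (r (i - 1))" "w \<in> positions (ts ! (i - 1))"
        using r(2) by auto
      then show ?thesis using Cons by (auto simp: is_run_def s_def)
    qed
  qed
  moreover have "s [] = q" by (simp add: s_def)
  ultimately show ?case by blast
qed

lemma evals_run:
  assumes A: "is_fta rk A" and t: "t \<in> trees rk" and r: "is_run A t r"
  shows "z \<in> positions t \<Longrightarrow>
    (\<And>z'. z' \<in> positions t \<Longrightarrow> prefix z z' \<Longrightarrow> length z' = length z + d \<Longrightarrow> R z' (r z')) \<Longrightarrow>
    evals A t R d z (r z)"
proof (induction d arbitrary: z)
  case 0
  then show ?case by simp
next
  case (Suc d)
  from r Suc.prems(1) obtain qs where qs: "(qs, lab t z, r z) \<in> delta A"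
    "\<And>i. i < length qs \<Longrightarrow> qs ! i = r (z @ [Suc i])" by (auto simp: is_run_def)
  from A qs have len: "length qs = rk (lab t z)" by (auto simp: is_fta_def)
  have pos: "z @ [Suc i] \<in> positions t" if "i < length qs" for i
    using child_in_positions_iff[OF t Suc.prems(1)] that len by simp
  have "evals A t R d (z @ [Suc i]) (qs ! i)" if "i < length qs" for i
    unfolding qs(2)[OF that]
  proof (rule Suc.IH[OF pos[OF that]])
    fix z' assume "z' \<in> positions t" "prefix (z @ [Suc i]) z'" "length z' = length (z @ [Suc i]) + d"
    then show "R z' (r z')" by (intro Suc.prems(2)) (auto dest: append_prefixD)
  qed
  with pos qs(1) show ?case by (auto intro!: bexI[of _ "(qs, lab t z, r z)"])
qed

section \<open>Definability of partial runs\<close>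

lemma finite_delta:
  fixes rk :: "'s::finite \<Rightarrow> nat"
  assumes "is_fta rk A" shows "finite (delta A)"
proof (rule finite_subset)
  show "delta A \<subseteq> {qs. set qs \<subseteq> states A \<and> length qs \<le> maxrk rk} \<times> UNIV \<times> states A"
    using assms rk_le_maxrk by (force simp: is_fta_def)
  show "finite ({qs. set qs \<subseteq> states A \<and> length qs \<le> maxrk rk} \<times> (UNIV :: 's set) \<times> states A)"
    using assms by (intro finite_cartesian_product finite_lists_length_le finite)
      (simp_all add: is_fta_def)
qed

context logic_class
begin

lemma definable_const: "definable V W (\<lambda>t \<rho> S. c)"
  by (cases c) (simp_all add: definable_True definable_False)

text \<open>For fixed \<open>d\<close> the recursion unfolds into finite disjunctions over
  transitions. \<open>R\<close> may depend on the parameters in \<open>Y\<close>;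
  \<open>indep\<close> ensures that fresh variables naming children do not disturb it.\<close>

lemma definable_evals:
  assumes A: "is_fta rk A" and Y: "finite Y"
    and R: "\<And>z q. definable (insert z Y) W (\<lambda>t \<rho> S. R t \<rho> (\<rho> z) q)"
    and indep: "\<And>t \<rho> z v. z \<notin> Y \<Longrightarrow> R t (\<rho>(z := v)) = R t \<rho>"
  shows "definable (insert z Y) W (\<lambda>t \<rho> S. evals A t (R t \<rho>) d (\<rho> z) q)"
proof (induction d arbitrary: z q)
  case 0
  then show ?case using R by simp
next
  case (Suc d)
  have child: "definable (insert z Y) W
      (\<lambda>t \<rho> S. \<rho> z @ [i] \<in> positions t \<and> evals A t (R t \<rho>) d (\<rho> z @ [i]) q)"
    if i: "1 \<le> i" "i \<le> maxrk rk" for i q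
  proof -
    obtain z' where z': "z' \<notin> insert z Y"
      using ex_new_if_finite[of "insert z Y"] infinite_UNIV_nat Y by blast
    have "definable (insert z' (insert z Y)) W (\<lambda>t \<rho> S. evals A t (R t \<rho>) d (\<rho> z') q)"
      by (rule definable_mono[OF Suc.IH[of z' q]]) auto
    then have "definable (insert z' (insert z Y)) W
        (\<lambda>t \<rho> S. \<rho> z' = \<rho> z @ [i] \<and> evals A t (R t \<rho>) d (\<rho> z') q)"
      using i by (intro definable_and definable_edge) auto
    then show ?thesis by (rule definable_ex1) (use z' indep in auto)
  qed
  have "definable (insert z Y) W (\<lambda>t \<rho> S. \<exists>tr \<in> delta A. snd (snd tr) = q \<and>
      lab t (\<rho> z) = fst (snd tr) \<and> (\<forall>i \<in> {..<length (fst tr)}. \<rho> z @ [Suc i] \<in> positions t \<and>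
         evals A t (R t \<rho>) d (\<rho> z @ [Suc i]) (fst tr ! i)))"
  proof (intro definable_Bex[OF finite_delta[OF A]] definable_and definable_const definable_label
      definable_Ball[OF finite_lessThan child])
    fix tr i assume "tr \<in> delta A" "i \<in> {..<length (fst tr)}"
    then have "i < rk (fst (snd tr))" using A by (auto simp: is_fta_def)
    then show "Suc i \<le> maxrk rk" using rk_le_maxrk[of rk "fst (snd tr)"] by simp
  qed simp_all
  then show ?case by (simp only: evals.simps case_prod_unfold)
qed

end

section \<open>First-order description of blocks and of transitions between them\<close>

lemma FO_mod_length':
  assumes "x \<in> V" "0 < n" shows "FO_mod.definable rk V W (\<lambda>t \<rho> S. length (\<rho> x) mod n = q)"
proof (cases "q < n")
  case False
  \<comment> \<open>The state parameters below are arbitrary numbers; those from \<open>n\<close>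
    onwards are not residues and give the empty relation.\<close>
  then have "length p mod n \<noteq> q" for p :: pos using assms(2) by auto
  then show ?thesis by (simp add: FO_mod.definable_False)
qed (use assms FO_mod_length in blast)

text \<open>Modulo atoms enter here, to recognize roots of blocks, and later in reading off the
  encoded state.\<close>

lemma FO_mod_base:
  assumes "x \<in> V" "y \<in> V" "0 < n"
  shows "FO_mod.definable rk V W (\<lambda>t \<rho> S. base n (\<rho> y) = \<rho> x)"
proof -
  have "FO_mod.definable rk V W (\<lambda>t \<rho> S. length (\<rho> x) mod n = 0 \<and>
      (\<exists>j \<in> {..<n}. prefix (\<rho> x) (\<rho> y) \<and> length (\<rho> y) = length (\<rho> x) + j))"
    using assms by (intro FO_mod.definable_and FO_mod.definable_Bex FO_mod.definable_distance
      FO_mod_length) simp_all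
  moreover have "base n v = u \<longleftrightarrow> length u mod n = 0 \<and>
      (\<exists>j \<in> {..<n}. prefix u v \<and> length v = length u + j)" for u v
    unfolding base_eq_iff[OF assms(3)] by (auto simp: prefix_def)
  ultimately show ?thesis by simp
qed

lemma FO_mod_base_path:
  assumes "x \<in> V" "y \<in> V" "0 < n" "set w \<subseteq> {1..maxrk rk}"
  shows "FO_mod.definable rk V W (\<lambda>t \<rho> S. base n (\<rho> y) = \<rho> x @ w)"
proof (rule FO_mod.definable_mono[of rk "{x, y}" W])
  obtain z where z: "z \<notin> {x, y}"
    using ex_new_if_finite[of "{x, y}"] infinite_UNIV_nat by blast
  show "FO_mod.definable rk {x, y} W (\<lambda>t \<rho> S. base n (\<rho> y) = \<rho> x @ w)"
  proof (rule FO_mod.definable_ex1)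
    show "FO_mod.definable rk (insert z {x, y}) W
        (\<lambda>t \<rho> S. \<rho> z = \<rho> x @ w \<and> base n (\<rho> y) = \<rho> z)"
      using assms by (intro FO_mod.definable_and FO_mod.definable_path FO_mod_base) simp_all
  next
    fix t :: "'a tree" and \<rho> :: "nat \<Rightarrow> pos" and S :: "nat \<Rightarrow> pos set"
    assume "range \<rho> \<subseteq> positions t"
    then have "base n (\<rho> y) \<in> positions t" using base_in_positions[OF assms(3)] by auto
    then show "base n (\<rho> y) = \<rho> x @ w \<longleftrightarrow> (\<exists>v \<in> positions t.
        (\<rho>(z := v)) z = (\<rho>(z := v)) x @ w \<and> base n ((\<rho>(z := v)) y) = (\<rho>(z := v)) z)"
      using z by auto
  qed
qed (use assms in auto)

text \<open>A position \<open>y\<close> encodes the state \<open>|y| mod n\<close> at the root \<open>base n y\<close> of its block; blocks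
  that are too short to contain all offsets are evaluated directly.\<close>

definition link :: "(nat, 's) fta \<Rightarrow> nat \<Rightarrow> 's tree \<Rightarrow> pos list \<Rightarrow> pos \<Rightarrow> nat \<Rightarrow> bool" where
  "link A n t ys z q \<longleftrightarrow> (\<exists>y \<in> set ys. base n y = z \<and> length y mod n = q) \<or>
     evals A t (\<lambda>_ _. False) n z q"

text \<open>Progress compares bases lexicographically, and there is no atom for this order. Relative
  to a common block root the next bases are given by words of length \<open>n\<close>, so the
  admissible tuples form a finite set that a formula can enumerate.\<close>

definition sorted_words :: "('s::finite \<Rightarrow> nat) \<Rightarrow> nat \<Rightarrow> nat \<Rightarrow> pos list set" where
  "sorted_words rk n k = {ws. set ws \<subseteq> words rk n \<and> length ws = k \<and>
     sorted_wrt (\<lambda>u u'. (u, u') \<in> lexord less_than) ws}"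

text \<open>The root position plays a special role: it has offset \<open>0\<close> but stands for all final states.\<close>

definition encodes :: "(nat, 's) fta \<Rightarrow> nat \<Rightarrow> pos \<Rightarrow> nat \<Rightarrow> bool" where
  "encodes A n x q \<longleftrightarrow> x = [] \<and> q \<in> final A \<or> x \<noteq> [] \<and> length x mod n = q"

text \<open>The first conjunct is there to force progress; the second lets \<open>x\<close> propose
  a state and verifies it by a partial run down to the next block roots.\<close>

definition step :: "('s::finite \<Rightarrow> nat) \<Rightarrow> (nat, 's) fta \<Rightarrow> nat \<Rightarrow> 's tree \<Rightarrow> pos \<Rightarrow> pos list \<Rightarrow> bool" where
  "step rk A n t x ys \<longleftrightarrow>
    (\<exists>ws \<in> sorted_words rk n (length ys). \<forall>i \<in> {..<length ys}. base n (ys ! i) = base n x @ ws ! i) \<and>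
    (\<exists>q \<in> states A. encodes A n x q \<and> evals A t (link A n t ys) n (base n x) q)"

lemma definable_link:
  assumes "is_fta rk A" "0 < n"
  shows "FO_mod.definable rk (insert z {1..<Suc k}) W
    (\<lambda>t \<rho> S. link A n t (map \<rho> [1..<Suc k]) (\<rho> z) q)"
proof -
  have "FO_mod.definable rk (insert z {}) W (\<lambda>t \<rho> S. evals A t (\<lambda>_ _. False) n (\<rho> z) q)"
    by (rule FO_mod.definable_evals[OF assms(1)]) (simp_all add: FO_mod.definable_False)
  then have "FO_mod.definable rk (insert z {1..<Suc k}) W
      (\<lambda>t \<rho> S. evals A t (\<lambda>_ _. False) n (\<rho> z) q)"
    by (rule FO_mod.definable_mono) auto
  then have "FO_mod.definable rk (insert z {1..<Suc k}) W (\<lambda>t \<rho> S.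
      (\<exists>i \<in> {1..<Suc k}. base n (\<rho> i) = \<rho> z \<and> length (\<rho> i) mod n = q) \<or>
      evals A t (\<lambda>_ _. False) n (\<rho> z) q)"
    using assms(2)
    by (intro FO_mod.definable_or FO_mod.definable_Bex FO_mod.definable_and FO_mod_base
        FO_mod_length') simp_all
  then show ?thesis by (simp only: link_def set_map set_upt bex_simps)
qed

lemma finite_sorted_words: "finite (sorted_words rk n k)"
proof (rule finite_subset)
  show "sorted_words rk n k \<subseteq> {ws. set ws \<subseteq> words rk n \<and> length ws = k}"
    by (auto simp: sorted_words_def)
qed (simp add: finite_lists_length_eq)

text \<open>The additional variable \<open>Suc k\<close> names the root of the block of
  \<open>x\<close>, which gives paths and partial runs a variable to start from.\<close>

lemma definable_step:
  assumes A: "is_fta rk A" and n: "0 < n"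
  shows "FO_mod.definable rk {0..k} {} (\<lambda>t \<rho> S. step rk A n t (\<rho> 0) (map \<rho> [1..<Suc k]))"
proof (rule FO_mod.definable_ex1)
  let ?b = "Suc k"
  have "FO_mod.definable rk (insert ?b {1..<Suc k}) {}
      (\<lambda>t \<rho> S. evals A t (link A n t (map \<rho> [1..<Suc k])) n (\<rho> ?b) q)" for q
  proof (rule FO_mod.definable_evals[OF A _ definable_link[OF A n]])
    fix t and \<rho> :: "nat \<Rightarrow> pos" and z v assume "z \<notin> {1..<Suc k}"
    then have "map (\<rho>(z := v)) [1..<Suc k] = map \<rho> [1..<Suc k]" by (intro map_cong) auto
    then show "link A n t (map (\<rho>(z := v)) [1..<Suc k]) = link A n t (map \<rho> [1..<Suc k])"
      by (simp only:)
  qed simp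
  then have "FO_mod.definable rk (insert ?b {0..k}) {}
      (\<lambda>t \<rho> S. evals A t (link A n t (map \<rho> [1..<Suc k])) n (\<rho> ?b) q)" for q
    by (rule FO_mod.definable_mono) auto
  moreover have "FO_mod.definable rk (insert ?b {0..k}) {}
      (\<lambda>t \<rho> S. \<rho> 0 = [] \<and> q \<in> final A \<or> \<rho> 0 \<noteq> [] \<and> length (\<rho> 0) mod n = q)" for q
    using n by (intro FO_mod.definable_and FO_mod.definable_or FO_mod.definable_const
        FO_mod.definable_not FO_mod.definable_root FO_mod_length') simp_all
  moreover have "finite (states A)" using A by (simp add: is_fta_def)
  ultimately have 1: "FO_mod.definable rk (insert ?b {0..k}) {} (\<lambda>t \<rho> S. \<exists>q \<in> states A.
      (\<rho> 0 = [] \<and> q \<in> final A \<or> \<rho> 0 \<noteq> [] \<and> length (\<rho> 0) mod n = q) \<and>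
       evals A t (link A n t (map \<rho> [1..<Suc k])) n (\<rho> ?b) q)"
    by (intro FO_mod.definable_Bex FO_mod.definable_and)
  have "set (ws ! i) \<subseteq> {1..maxrk rk}" if "ws \<in> sorted_words rk n k" "i < k" for ws i
  proof -
    have "ws ! i \<in> set ws" using that by (simp add: sorted_words_def)
    then have "ws ! i \<in> words rk n" using that by (auto simp: sorted_words_def)
    then show ?thesis by (simp add: words_def)
  qed
  then have 2: "FO_mod.definable rk (insert ?b {0..k}) {} (\<lambda>t \<rho> S.
      \<exists>ws \<in> sorted_words rk n k. \<forall>i \<in> {..<k}. base n (\<rho> (Suc i)) = \<rho> ?b @ ws ! i)"
    using n by (intro FO_mod.definable_Bex FO_mod.definable_Ball FO_mod_base_path
        finite_sorted_words) simp_all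
  have 3: "FO_mod.definable rk (insert ?b {0..k}) {} (\<lambda>t \<rho> S. base n (\<rho> 0) = \<rho> ?b)"
    using n by (intro FO_mod_base) simp_all
  show "FO_mod.definable rk (insert ?b {0..k}) {} (\<lambda>t \<rho> S. base n (\<rho> 0) = \<rho> ?b \<and>
    (\<exists>ws \<in> sorted_words rk n k. \<forall>i \<in> {..<k}. base n (\<rho> (Suc i)) = \<rho> ?b @ ws ! i) \<and>
    (\<exists>q \<in> states A. (\<rho> 0 = [] \<and> q \<in> final A \<or> \<rho> 0 \<noteq> [] \<and> length (\<rho> 0) mod n = q) \<and>
       evals A t (link A n t (map \<rho> [1..<Suc k])) n (\<rho> ?b) q))"
    by (rule FO_mod.definable_and[OF 3 FO_mod.definable_and[OF 2 1]])
next
  let ?b = "Suc k"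
  fix t :: "'a tree" and \<rho> :: "nat \<Rightarrow> pos" and S :: "nat \<Rightarrow> pos set"
  assume "range \<rho> \<subseteq> positions t"
  then have b: "base n (\<rho> 0) \<in> positions t" using base_in_positions[OF n] by auto
  have "map (\<rho>(?b := v)) [1..<Suc k] = map \<rho> [1..<Suc k]" for v by (intro map_cong) auto
  moreover have "(\<forall>i \<in> {..<k}. base n ((\<rho>(?b := v)) (Suc i)) = u @ ws ! i) \<longleftrightarrow>
      (\<forall>i \<in> {..<k}. base n (map \<rho> [1..<Suc k] ! i) = u @ ws ! i)" for u v ws
    by (intro ball_cong) (simp_all del: upt_Suc)
  ultimately show "step rk A n t (\<rho> 0) (map \<rho> [1..<Suc k]) \<longleftrightarrow> (\<exists>v \<in> positions t.
    base n ((\<rho>(?b := v)) 0) = (\<rho>(?b := v)) ?b \<and>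
    (\<exists>ws \<in> sorted_words rk n k. \<forall>i \<in> {..<k}.
      base n ((\<rho>(?b := v)) (Suc i)) = (\<rho>(?b := v)) ?b @ ws ! i) \<and>
    (\<exists>q \<in> states A. ((\<rho>(?b := v)) 0 = [] \<and> q \<in> final A \<or>
        (\<rho>(?b := v)) 0 \<noteq> [] \<and> length ((\<rho>(?b := v)) 0) mod n = q) \<and>
       evals A t (link A n t (map (\<rho>(?b := v)) [1..<Suc k])) n ((\<rho>(?b := v)) ?b) q))"
    using b by (simp add: step_def encodes_def del: upt_Suc fun_upd_apply) (simp del: upt_Suc)
qed

section \<open>Correctness of the transitions between blocks\<close>

lemma step_imp_progress:
  assumes "step rk A n t x ys" shows "progress n x ys"
proof -
  from assms obtain ws where ws: "ws \<in> sorted_words rk n (length ys)"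
    "\<And>i. i < length ys \<Longrightarrow> base n (ys ! i) = base n x @ ws ! i"
    by (auto simp: step_def)
  then have eq: "map (base n) ys = map ((@) (base n x)) ws"
    by (intro nth_equalityI) (auto simp: sorted_words_def)
  have "base n y \<in> (@) (base n x) ` set ws" if "y \<in> set ys" for y
    using that arg_cong[OF eq, of set] by auto
  then have "prefix (base n x) (base n y) \<and> length (base n y) = length (base n x) + n"
    if "y \<in> set ys" for y
    using that ws(1) by (fastforce simp: sorted_words_def words_def)
  moreover have "sorted_wrt (\<lambda>u u'. (u, u') \<in> lexord less_than) (map (base n) ys)"
    unfolding eq sorted_wrt_map using ws(1)
    by (auto simp: sorted_words_def intro: lexord_append_leftI elim!: sorted_wrt_mono_rel[rotated])
  ultimately show ?thesis by (simp add: progress_def)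
qed

text \<open>Positions other than the root encode a unique state, so the state supplied by the
  induction hypothesis is the one that \<open>link\<close> reads off. The existential leaves a real
  choice only at the root, among the final states.\<close>

lemma step_closed_imp_reaches:
  assumes A: "is_fta rk A" and n: "0 < n" and t: "t \<in> trees rk" and X: "X \<subseteq> positions t"
    and closed: "\<And>x. x \<in> X \<Longrightarrow> \<exists>ys. set ys \<subseteq> X \<and> step rk A n t x ys"
    and "x \<in> X"
  shows "\<exists>q. encodes A n x q \<and> reaches A (subtree t (base n x)) q"
proof -
  from \<open>x \<in> X\<close> X have "x \<in> positions t" by blast
  with n have "x \<in> X \<longrightarrow> (\<exists>q. encodes A n x q \<and> reaches A (subtree t (base n x)) q)"
  proof (induction x rule: positions_induct_base)
    case (less x)
    show ?case
    proof
      assume "x \<in> X"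
      then obtain ys where ys: "set ys \<subseteq> X" "step rk A n t x ys" using closed by blast
      then obtain q where q: "encodes A n x q" "evals A t (link A n t ys) n (base n x) q"
        by (auto simp: step_def)
      have "reaches A (subtree t (base n x)) q"
      proof (rule evals_sound[OF A t base_in_positions[OF n less(1)] q(2)])
        fix z p assume z: "z \<in> positions t" "length z = length (base n x) + n"
          and "link A n t ys z p"
        then consider y where "y \<in> set ys" "base n y = z" "length y mod n = p"
          | "evals A t (\<lambda>_ _. False) n z p" by (auto simp: link_def)
        then show "reaches A (subtree t z) p"
        proof cases
          case 1
          then have "y \<in> X" "y \<in> positions t" using ys X by auto
          with less(2)[of y] 1 z n obtain p' where p': "encodes A n y p'" "reaches A (subtree t z) p'"
            by auto
          \<comment> \<open>The base of \<open>y\<close> has positive depth, so the convention for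
            the root does not apply to \<open>y\<close>.\<close>
          have "y \<noteq> []" using 1(2) z(2) n by auto
          with p'(1) 1(3) have "p' = p" by (simp add: encodes_def)
          with p'(2) show ?thesis by simp
        next
          case 2
          then show ?thesis by (rule evals_sound[OF A t z(1)]) simp
        qed
      qed
      with q(1) show "\<exists>q. encodes A n x q \<and> reaches A (subtree t (base n x)) q" by blast
    qed
  qed
  with \<open>x \<in> X\<close> show ?thesis by blast
qed

text \<open>Identifies the lexicographic relation with the order on lists from
  \<open>List_Lexorder\<close>, so that \<open>sorted_list_of_set\<close> yields admissible
  tuples.\<close>

lemma sorted_wrt_lexord_sorted_list_of_set:
  "finite Z \<Longrightarrow> sorted_wrt (\<lambda>u u'. (u, u') \<in> lexord less_than) (sorted_list_of_set (Z :: pos set))"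
proof -
  have "less_than = {(u :: nat, v). u < v}" by auto
  then have "(u, u') \<in> lexord less_than \<longleftrightarrow> u < u'" for u u' :: pos by (simp add: list_less_def)
  then show ?thesis using strict_sorted_list_of_set[of Z] by (simp only:)
qed

lemma reaches_imp_step_closed:
  assumes A: "is_fta rk A" and n: "states A \<subseteq> {..<n}" "0 < n" and t: "t \<in> trees rk"
    and q: "q \<in> final A" "reaches A t q"
  shows "\<exists>X \<subseteq> positions t. [] \<in> X \<and> (\<forall>x \<in> X. \<exists>ys. length ys \<le> card (words rk n) \<and>
    set ys \<subseteq> X \<and> step rk A n t x ys)"
proof -
  from reaches_imp_run[OF q(2)] obtain r where r: "r [] = q" "is_run A t r" by (elim exE conjE)
  then have states: "r p \<in> states A" if "p \<in> positions t" for p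
    using that A unfolding is_run_def is_fta_def by blast
  \<comment> \<open>A position at offset \<open>n - 1\<close> makes every offset below
    \<open>n\<close> available through its prefixes.\<close>
  define tall where "tall z \<longleftrightarrow> (\<exists>p. length p = n - 1 \<and> z @ p \<in> positions t)" for z
  \<comment> \<open>All encodings of the run in tall blocks; the root is added whatever its state
    and the height of its block.\<close>
  define X where "X = insert [] {v \<in> positions t. tall (base n v) \<and> length v mod n = r (base n v)}"
  have pick: "\<exists>y \<in> X. base n y = z \<and> length y mod n = r z"
    if z: "z \<in> positions t" "n dvd length z" "tall z" for z
  proof -
    from z(3) obtain p where p: "length p = n - 1" "z @ p \<in> positions t" by (auto simp: tall_def)
    have rz: "r z < n" using states[OF z(1)] n by auto
    \<comment> \<open>The prefix of the long path whose offset is the state of the run at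
      \<open>z\<close>.\<close>
    let ?y = "z @ take (r z) p"
    have len: "length ?y = length z + r z" using p(1) rz by simp
    have "?y \<in> positions t"
      using p(2) by (rule positions_prefix) (simp add: take_is_prefix)
    moreover have b: "base n ?y = z" using base_eq_iff[OF n(2)] z(2) len rz by auto
    moreover have "length ?y mod n = r z" using len rz z(2) by (auto elim!: dvdE)
    ultimately show ?thesis using z(3) by (intro bexI[of _ ?y]) (auto simp: X_def)
  qed
  have "\<exists>ys. length ys \<le> card (words rk n) \<and> set ys \<subseteq> X \<and> step rk A n t x ys" if x: "x \<in> X" for x
  proof -
    let ?b = "base n x"
    have xpos: "x \<in> positions t" using x by (auto simp: X_def)
    have b: "?b \<in> positions t" "n dvd length ?b"
      using base_in_positions[OF n(2) xpos] base_eq_iff[OF n(2), of x ?b] by auto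
    \<comment> \<open>Only tall blocks receive a successor; the remaining ones are covered by the
      second disjunct of \<open>link\<close>.\<close>
    define Z where "Z = {w \<in> words rk n. ?b @ w \<in> positions t \<and> tall (?b @ w)}"
    have Z: "finite Z" by (simp add: Z_def)
    define ws where "ws = sorted_list_of_set Z"
    have ws: "set ws = Z" "ws \<in> sorted_words rk n (length ws)"
      using sorted_wrt_lexord_sorted_list_of_set[OF Z] Z
      by (auto simp: ws_def sorted_words_def Z_def)
    have "\<exists>y \<in> X. base n y = ?b @ w \<and> length y mod n = r (?b @ w)" if "w \<in> Z" for w
      by (rule pick) (use that b(2) in \<open>auto simp: Z_def words_def\<close>)
    then obtain f where f: "\<And>w. w \<in> Z \<Longrightarrow> f w \<in> X" "\<And>w. w \<in> Z \<Longrightarrow> base n (f w) = ?b @ w"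
      "\<And>w. w \<in> Z \<Longrightarrow> length (f w) mod n = r (?b @ w)" by metis
    let ?ys = "map f ws"
    have evals: "evals A t (link A n t ?ys) n ?b (r ?b)"
    proof (rule evals_run[OF A t r(2) b(1)])
      fix z assume z: "z \<in> positions t" "prefix ?b z" "length z = length ?b + n"
      show "link A n t ?ys z (r z)"
      proof (cases "tall z")
        case True
        from z append_word_iff[OF t z(1)] obtain w where w: "w \<in> words rk n" "z = ?b @ w" by blast
        with z True have "w \<in> Z" by (simp add: Z_def)
        with f w ws(1) show ?thesis by (auto simp: link_def intro!: exI[of _ w])
      next
        case False
        have "evals A t (\<lambda>_ _. False) n z (r z)"
        proof (rule evals_run[OF A t r(2) z(1)])
          \<comment> \<open>A block that is not tall has an empty frontier, so any position found
            there is contradictory.\<close>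
          fix z' assume z': "z' \<in> positions t" "prefix z z'" "length z' = length z + n"
          then obtain p where p: "z' = z @ p" "length p = n" by (auto simp: prefix_def)
          have "z @ take (n - 1) p \<in> positions t"
            using z'(1) unfolding p(1) by (rule positions_prefix) (simp add: take_is_prefix)
          then have "tall z" using p(2) unfolding tall_def by (intro exI[of _ "take (n - 1) p"]) auto
          with False show False by simp
        qed
        then show ?thesis by (simp add: link_def)
      qed
    qed
    have "step rk A n t x ?ys"
      unfolding step_def encodes_def
    proof (intro conjI bexI[of _ ws] bexI[of _ "r ?b"] evals)
      show "\<forall>i\<in>{..<length ?ys}. base n (?ys ! i) = ?b @ ws ! i"
        using f(2) nth_mem[of _ ws] unfolding ws(1) by simp
      show "x = [] \<and> r ?b \<in> final A \<or> x \<noteq> [] \<and> length x mod n = r ?b"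
        using x r(1) q(1) n(2) by (cases "x = []") (auto simp: X_def)
    qed (use ws states[OF b(1)] in simp_all)
    moreover have "length ?ys \<le> card (words rk n)"
      unfolding ws_def using Z by (auto simp: Z_def intro: card_mono)
    moreover have "set ?ys \<subseteq> X" using f(1) ws(1) by auto
    ultimately show ?thesis by blast
  qed
  then show ?thesis by (intro exI[of _ X]) (auto simp: X_def)
qed

lemma BTC_definable_if_recognizable:
  fixes rk :: "'s::finite \<Rightarrow> nat"
  assumes "recognizable rk L" shows "BTC_definable rk (FO_mod rk) L"
proof -
  from assms obtain A :: "(nat, 's) fta" where A: "is_fta rk A"
    and L: "L = {t \<in> trees rk. \<exists>q \<in> final A. reaches A t q}"
    unfolding recognizable_def by blast
  \<comment> \<open>Every state is then a residue modulo \<open>n\<close>; inserting 0 covers an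
    automaton without states.\<close>
  define n where "n = Suc (Max (insert 0 (states A)))"
  have "finite (states A)" using A by (simp add: is_fta_def)
  then have n: "states A \<subseteq> {..<n}" "0 < n" by (auto simp: n_def less_Suc_eq_le)
  \<comment> \<open>In the constructed closed set the successors have distinct offset words, so this
    number bounds how many there are.\<close>
  let ?m = "card (words rk n)"
  have "\<forall>k. \<exists>\<phi> \<in> FO_mod rk. free1 \<phi> \<subseteq> {0..k} \<and> free2 \<phi> = {} \<and> (\<forall>t \<in> trees rk. \<forall>\<rho> S.
      range \<rho> \<subseteq> positions t \<longrightarrow> sat t \<rho> S \<phi> = step rk A n t (\<rho> 0) (map \<rho> [1..<Suc k]))"
    using definable_step[OF A n(2)] unfolding FO_mod.definable_def by simp
  then obtain \<Phi> where \<Phi>: "\<And>k. \<Phi> k \<in> FO_mod rk" "\<And>k. free1 (\<Phi> k) \<subseteq> {0..k}" "\<And>k. free2 (\<Phi> k) = {}"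
    and sat: "\<And>k t \<rho> S. t \<in> trees rk \<Longrightarrow> range \<rho> \<subseteq> positions t \<Longrightarrow>
      sat t \<rho> S (\<Phi> k) = step rk A n t (\<rho> 0) (map \<rho> [1..<Suc k])"
    by metis
  have holds: "holds_at t (\<Phi> (length vs)) v vs = step rk A n t v vs"
    if "t \<in> trees rk" "v \<in> positions t" "set vs \<subseteq> positions t" for t v vs
  proof -
    define \<rho> where "\<rho> i = (if i \<le> length vs then (v # vs) ! i else [])" for i
    have "(v # vs) ! i \<in> set (v # vs)" if "i \<le> length vs" for i
      using that by (intro nth_mem) simp
    moreover have "set (v # vs) \<subseteq> positions t" using that by simp
    ultimately have "\<rho> i \<in> positions t" for i unfolding \<rho>_def by (metis Nil_in_positions subsetD)
    then have "range \<rho> \<subseteq> positions t" by blast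
    moreover have "map \<rho> [1..<Suc (length vs)] = vs"
      by (rule nth_equalityI) (simp_all add: \<rho>_def del: upt_Suc)
    moreover have "\<rho> 0 = v" by (simp add: \<rho>_def)
    ultimately show ?thesis
      using sat[OF that(1), of \<rho> "\<lambda>_. {}" "length vs"] by (simp add: holds_at_def \<rho>_def[abs_def])
  qed
  have fam: "is_family (FO_mod rk) ?m \<Phi>" using \<Phi> by (simp add: is_family_def)
  have prog: "progressing rk n ?m \<Phi>"
    unfolding progressing_def using holds step_imp_progress by blast
  have "(\<exists>q \<in> final A. reaches A t q) \<longleftrightarrow> btc_holds t ?m \<Phi> []" if t: "t \<in> trees rk" for t
    unfolding btc_holds_iff[OF fam prog n(2) t]
  proof
    assume "\<exists>q \<in> final A. reaches A t q"
    then obtain X where X: "X \<subseteq> positions t" "[] \<in> X" "\<forall>x \<in> X. \<exists>ys. length ys \<le> ?m \<and>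
        set ys \<subseteq> X \<and> step rk A n t x ys"
      using reaches_imp_step_closed[OF A n t] by (elim bexE) metis
    have "btc_closed t ?m \<Phi> X"
      unfolding btc_closed_def
    proof (intro conjI ballI)
      fix v assume "v \<in> X"
      with X obtain vs where "length vs \<le> ?m" "set vs \<subseteq> X" "step rk A n t v vs" by blast
      with \<open>v \<in> X\<close> X(1) t show "\<exists>vs. length vs \<le> ?m \<and> set vs \<subseteq> X \<and> holds_at t (\<Phi> (length vs)) v vs"
        by (intro exI[of _ vs]) (auto simp: holds subset_iff)
    qed (rule X(1))
    with X(2) show "\<exists>X. btc_closed t ?m \<Phi> X \<and> [] \<in> X" by blast
  next
    assume "\<exists>X. btc_closed t ?m \<Phi> X \<and> [] \<in> X"
    then obtain X where X: "btc_closed t ?m \<Phi> X" "[] \<in> X" by blast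
    then have pos: "X \<subseteq> positions t" by (simp add: btc_closed_def)
    have "\<exists>ys. set ys \<subseteq> X \<and> step rk A n t x ys" if "x \<in> X" for x
    proof -
      from X(1) that obtain vs where "set vs \<subseteq> X" "holds_at t (\<Phi> (length vs)) x vs"
        unfolding btc_closed_def by blast
      with holds[OF t] pos that show ?thesis by blast
    qed
    from step_closed_imp_reaches[OF A n(2) t pos this X(2)]
    show "\<exists>q \<in> final A. reaches A t q" using n(2) by (auto simp: encodes_def)
  qed
  with L fam prog n(2) show ?thesis unfolding BTC_definable_def
    by (intro exI[of _ ?m] exI[of _ n] exI[of _ \<Phi>]) auto
qed

lemma recognizable_if_EA_definable:
  fixes rk :: "'s::finite \<Rightarrow> nat"
  assumes "EA_definable rk (MSO rk) L" shows "recognizable rk L"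
proof -
  from assms obtain \<theta> :: "('s, nat) fm" and X x
    where \<theta>: "\<theta> \<in> MSO rk" "free1 \<theta> \<subseteq> {x}" "free2 \<theta> \<subseteq> {X}"
    and L: "L = {t \<in> trees rk. models t (Ex2 X (All1 x \<theta>))}"
    unfolding EA_definable_def by blast
  show ?thesis unfolding L by (rule mso_recognizable) (use \<theta> in \<open>auto simp: MSO_def\<close>)
qed

theorem corollary4p2:
  fixes rk :: "'s::finite \<Rightarrow> nat" and L :: "'s tree set"
  assumes "L \<subseteq> trees rk"
  shows "(recognizable rk L \<longleftrightarrow> BTC_definable rk (FO_mod rk) L) \<and>
         (BTC_definable rk (FO_mod rk) L \<longleftrightarrow> BTC_definable rk (MSO rk) L) \<and>
         (BTC_definable rk (MSO rk) L \<longleftrightarrow> EA_definable rk (FO_mod rk) L) \<and>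
         (EA_definable rk (FO_mod rk) L \<longleftrightarrow> EA_definable rk (MSO rk) L) \<and>
         (EA_definable rk (MSO rk) L \<longleftrightarrow> MSO_definable rk L)"
proof -
  \<comment> \<open>The implications form a single cycle: from automata through BTC and
    \<exists>\<forall> over FO with modulo atoms to MSO sentences, then through BTC and
    \<exists>\<forall> over MSO back to automata.\<close>
  have "recognizable rk L \<Longrightarrow> BTC_definable rk (FO_mod rk) L"
    by (rule BTC_definable_if_recognizable)
  moreover have "BTC_definable rk (FO_mod rk) L \<Longrightarrow> EA_definable rk (FO_mod rk) L"
    by (rule FO_mod.EA_definable_if_BTC_definable)
  moreover have "EA_definable rk (FO_mod rk) L \<Longrightarrow> MSO_definable rk L"
    by (rule MSO_definable_if_EA_definable)
  moreover have "MSO_definable rk L \<Longrightarrow> BTC_definable rk (MSO rk) L"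
    by (rule BTC_definable_if_MSO_definable)
  moreover have "BTC_definable rk (MSO rk) L \<Longrightarrow> EA_definable rk (MSO rk) L"
    by (rule MSO.EA_definable_if_BTC_definable)
  moreover have "EA_definable rk (MSO rk) L \<Longrightarrow> recognizable rk L"
    by (rule recognizable_if_EA_definable)
  ultimately show ?thesis by blast
qed

end
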